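(* Let $\varepsilon>0$ and let $P,Q$ be Borel probability measures on $\mathbb{R}^d$ that do not charge the boundary of any convex subset of $\mathbb{R}^d$, whose topological supports $\Omega:=\operatorname{spt}P$ and $\Omega':=\operatorname{spt}Q$ are compact, and such that $\Omega'$ is connected. Let $f_0:\Omega\to\mathbb{R}$ and $g_0:\Omega'\to\mathbb{R}$ be Lipschitz continuous with $\int f_0\,dP=\int g_0\,dQ$, let $\eta\in(0,\varepsilon)$, and let $(f_n,g_n)_{n\ge0}$ be the gradient descent iterates with step size $\eta$ started at $(f_0,g_0)$. Let $\mathbb{L}_n$ and $\mathbb{L}$ be the operators on $L^2_\oplus$ defined in the context. Then $$\|\mathbb{L}_n-\mathbb{L}\|_{\mathrm{op}}\to0\qquad\text{as } n\to\infty,$$ where $\|\cdot\|_{\mathrm{op}}$ is the operator norm on $L^2_\oplus$.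
   Context: $L^2_\oplus:=\{(f,g)\in L^2(P)\times L^2(Q):\int f\,dP=\int g\,dQ\}$ with the inner product inherited from $L^2(P)\times L^2(Q)$. The orthogonal projection $\operatorname{proj}_\oplus:L^2(P)\times L^2(Q)\to L^2_\oplus$ is $(f,g)\mapsto\big(f+\frac12(\int g\,dQ-\int f\,dP),\; g-\frac12(\int g\,dQ-\int f\,dP)\big)$. Write $(t)_+=\max\{t,0\}$; $\mathcal{L}_1$ is one-dimensional Lebesgue measure. The potentials $(f_*,g_* )$ are the unique pair of continuous functions $f_*:\Omega\to\mathbb{R}$, $g_*:\Omega'\to\mathbb{R}$ with $\int f_*\,dP=\int g_*\,dQ$ solving $\varepsilon=\int(f_*(x)+g_*(y)-\frac12\|x-y\|^2)_+\,dP(x)$ for all $y\in\Omega'$ and $\varepsilon=\int(f_*(x)+g_*(y)-\frac12\|x-y\|^2)_+\,dQ(y)$ for all $x\in\Omega$. Gradient descent iterates: for $n\ge0$, $f_{n+1}(x)=f_n(x)+\eta\big(1-\frac1\varepsilon\int(f_n(x)+g_n(y)-\frac12\|x-y\|^2)_+dQ(y)\big)$ for $x\in\Omega$ and $g_{n+1}(y)=g_n(y)+\eta\big(1-\frac1\varepsilon\int(f_n(x)+g_n(y)-\frac12\|x-y\|^2)_+dP(x)\big)$ for $y\in\Omega'$. Operator $\mathbb{L}:L^2_\oplus\to L^2_\oplus$: with $\mathcal{S}_x:=\{y\in\Omega': f_*(x)+g_*(y)\ge\frac12\|x-y\|^2\}$ and $\mathcal{T}_y:=\{x\in\Omega: f_*(x)+g_*(y)\ge\frac12\|x-y\|^2\}$,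 $$\mathbb{L}\begin{pmatrix}f\\ g\end{pmatrix}=\operatorname{proj}_\oplus\begin{pmatrix} f\,\big(1-\frac{\eta}{\varepsilon}Q(\mathcal{S}_{(\cdot)})\big)-\frac{\eta}{\varepsilon}\int_{\mathcal{S}_{(\cdot)}}g\,dQ\\ g\,\big(1-\frac{\eta}{\varepsilon}P(\mathcal{T}_{(\cdot)})\big)-\frac{\eta}{\varepsilon}\int_{\mathcal{T}_{(\cdot)}}f\,dP\end{pmatrix}.$$ Operators $\mathbb{L}_n:L^2_\oplus\to L^2_\oplus$: with $$\mathcal{S}_{n,x}:=\{(\lambda,y)\in[0,1]\times\Omega':\lambda(f_*(x)+g_*(y))+(1-\lambda)(f_n(x)+g_n(y))\ge\tfrac12\|x-y\|^2\},$$ $$\mathcal{T}_{n,y}:=\{(\lambda,x)\in[0,1]\times\Omega:\lambda(f_*(x)+g_*(y))+(1-\lambda)(f_n(x)+g_n(y))\ge\tfrac12\|x-y\|^2\},$$ $$\mathbb{L}_n\begin{pmatrix}f\\ g\end{pmatrix}=\operatorname{proj}_\oplus\begin{pmatrix} f\,\big(1-\frac{\eta}{\varepsilon}[\mathcal{L}_1\otimes Q](\mathcal{S}_{n,(\cdot)})\big)-\frac{\eta}{\varepsilon}\int_{\mathcal{S}_{n,(\cdot)}}g(y)\,d[\mathcal{L}_1\otimes Q](\lambda,y)\\ g\,\big(1-\frac{\eta}{\varepsilon}[\mathcal{L}_1\otimes P](\mathcal{T}_{n,(\cdot)})\big)-\frac{\eta}{\varepsilon}\int_{\mathcal{T}_{n,(\cdot)}}f(x)\,d[\mathcal{L}_1\otimes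 P](\lambda,x)\end{pmatrix}.$$ In both formulas the first component is a function of $x\in\Omega$ and the second of $y\in\Omega'$. *)

theory Defs
  imports "HOL-Probability.Probability"
begin

text \<open>
  Functions on the support of a measure are represented by total functions that are only ever
  evaluated on the support: every integral of a potential or an iterate is a set integral over the
  support, so the (possibly non-measurable) values elsewhere are irrelevant.  Elements of the
  \<open>L\<^sup>2\<close> spaces are represented by square-integrable functions rather than by classes modulo
  almost-everywhere equality.
\<close>

definition spt :: "'a::topological_space measure \<Rightarrow> 'a set" where
  "spt M = {x. \<forall>U. open U \<longrightarrow> x \<in> U \<longrightarrow> 0 < emeasure M U}"

definition slack :: "('a::real_normed_vector \<Rightarrow> real) \<Rightarrow> ('a \<Rightarrow> real) \<Rightarrow> 'a \<Rightarrow> 'a \<Rightarrow> real" where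
  "slack f g x y = f x + g y - (norm (x - y))\<^sup>2 / 2"

definition potentials ::
  "'a::euclidean_space measure \<Rightarrow> 'a measure \<Rightarrow> real \<Rightarrow> ('a \<Rightarrow> real) \<Rightarrow> ('a \<Rightarrow> real) \<Rightarrow> bool" where
  "potentials P Q \<epsilon> f g \<longleftrightarrow>
     continuous_on (spt P) f \<and> continuous_on (spt Q) g \<and>
     (LINT x:spt P|P. f x) = (LINT y:spt Q|Q. g y) \<and>
     (\<forall>y\<in>spt Q. \<epsilon> = (LINT x:spt P|P. max (slack f g x y) 0)) \<and>
     (\<forall>x\<in>spt P. \<epsilon> = (LINT y:spt Q|Q. max (slack f g x y) 0))"

primrec gd_iter ::
  "'a::euclidean_space measure \<Rightarrow> 'a measure \<Rightarrow> real \<Rightarrow> real \<Rightarrow> ('a \<Rightarrow> real) \<Rightarrow> ('a \<Rightarrow> real) \<Rightarrow> nat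
    \<Rightarrow> ('a \<Rightarrow> real) \<times> ('a \<Rightarrow> real)" where
  "gd_iter P Q \<epsilon> \<eta> f0 g0 0 = (f0, g0)"
| "gd_iter P Q \<epsilon> \<eta> f0 g0 (Suc n) =
     (let (f, g) = gd_iter P Q \<epsilon> \<eta> f0 g0 n in
       (\<lambda>x. f x + \<eta> * (1 - 1 / \<epsilon> * (LINT y:spt Q|Q. max (slack f g x y) 0)),
        \<lambda>y. g y + \<eta> * (1 - 1 / \<epsilon> * (LINT x:spt P|P. max (slack f g x y) 0))))"

definition L2_space :: "'a measure \<Rightarrow> ('a \<Rightarrow> real) set" where
  "L2_space M = {f \<in> borel_measurable M. integrable M (\<lambda>x. (f x)\<^sup>2)}"

definition L2_oplus :: "'a measure \<Rightarrow> 'a measure \<Rightarrow> (('a \<Rightarrow> real) \<times> ('a \<Rightarrow> real)) set" where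
  "L2_oplus P Q =
     {(f, g). f \<in> L2_space P \<and> g \<in> L2_space Q \<and> (LINT x|P. f x) = (LINT y|Q. g y)}"

definition L2_norm :: "'a measure \<Rightarrow> 'a measure \<Rightarrow> ('a \<Rightarrow> real) \<times> ('a \<Rightarrow> real) \<Rightarrow> real" where
  "L2_norm P Q = (\<lambda>(f, g). sqrt ((LINT x|P. (f x)\<^sup>2) + (LINT y|Q. (g y)\<^sup>2)))"

text \<open>
  The infimum is taken in the extended reals, so the operator norm is infinite when \<open>T\<close> does not map
  the space boundedly into itself.
\<close>

definition op_norm_oplus ::
  "'a measure \<Rightarrow> 'a measure \<Rightarrow>
    (('a \<Rightarrow> real) \<times> ('a \<Rightarrow> real) \<Rightarrow> ('a \<Rightarrow> real) \<times> ('a \<Rightarrow> real)) \<Rightarrow> ennreal" where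
  "op_norm_oplus P Q T =
     Inf {ennreal C | C. 0 \<le> C \<and>
       (\<forall>u\<in>L2_oplus P Q. T u \<in> L2_oplus P Q \<and> L2_norm P Q (T u) \<le> C * L2_norm P Q u)}"

definition pair_diff ::
  "('a \<Rightarrow> real) \<times> ('a \<Rightarrow> real) \<Rightarrow> ('a \<Rightarrow> real) \<times> ('a \<Rightarrow> real) \<Rightarrow> ('a \<Rightarrow> real) \<times> ('a \<Rightarrow> real)" where
  "pair_diff u v = (\<lambda>x. fst u x - fst v x, \<lambda>y. snd u y - snd v y)"

definition proj_oplus ::
  "'a measure \<Rightarrow> 'a measure \<Rightarrow> ('a \<Rightarrow> real) \<times> ('a \<Rightarrow> real) \<Rightarrow> ('a \<Rightarrow> real) \<times> ('a \<Rightarrow> real)" where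
  "proj_oplus P Q = (\<lambda>(f, g).
     (\<lambda>x. f x + 1/2 * ((LINT y|Q. g y) - (LINT x|P. f x)),
      \<lambda>y. g y - 1/2 * ((LINT y|Q. g y) - (LINT x|P. f x))))"

definition S_set ::
  "'a::euclidean_space measure \<Rightarrow> ('a \<Rightarrow> real) \<Rightarrow> ('a \<Rightarrow> real) \<Rightarrow> 'a \<Rightarrow> 'a set" where
  "S_set Q fs gs x = {y \<in> spt Q. fs x + gs y \<ge> (norm (x - y))\<^sup>2 / 2}"

definition T_set ::
  "'a::euclidean_space measure \<Rightarrow> ('a \<Rightarrow> real) \<Rightarrow> ('a \<Rightarrow> real) \<Rightarrow> 'a \<Rightarrow> 'a set" where
  "T_set P fs gs y = {x \<in> spt P. fs x + gs y \<ge> (norm (x - y))\<^sup>2 / 2}"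

text \<open>
  In the two operators below, the argument of the projection is set to zero off the supports, whose
  complements are null sets: there the potentials and iterates carry no information.
\<close>

definition L_op ::
  "'a::euclidean_space measure \<Rightarrow> 'a measure \<Rightarrow> real \<Rightarrow> real \<Rightarrow> ('a \<Rightarrow> real) \<Rightarrow> ('a \<Rightarrow> real)
    \<Rightarrow> ('a \<Rightarrow> real) \<times> ('a \<Rightarrow> real) \<Rightarrow> ('a \<Rightarrow> real) \<times> ('a \<Rightarrow> real)" where
  "L_op P Q \<epsilon> \<eta> fs gs = (\<lambda>(f, g). proj_oplus P Q
     (\<lambda>x. if x \<in> spt P
          then f x * (1 - \<eta> / \<epsilon> * measure Q (S_set Q fs gs x))
               - \<eta> / \<epsilon> * (LINT y:S_set Q fs gs x|Q. g y)
          else 0,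
      \<lambda>y. if y \<in> spt Q
          then g y * (1 - \<eta> / \<epsilon> * measure P (T_set P fs gs y))
               - \<eta> / \<epsilon> * (LINT x:T_set P fs gs y|P. f x)
          else 0))"

definition Sn_set ::
  "'a::euclidean_space measure \<Rightarrow> ('a \<Rightarrow> real) \<Rightarrow> ('a \<Rightarrow> real) \<Rightarrow> ('a \<Rightarrow> real) \<Rightarrow> ('a \<Rightarrow> real)
    \<Rightarrow> 'a \<Rightarrow> (real \<times> 'a) set" where
  "Sn_set Q fs gs fn gn x =
     {(l, y). l \<in> {0..1} \<and> y \<in> spt Q \<and>
        l * (fs x + gs y) + (1 - l) * (fn x + gn y) \<ge> (norm (x - y))\<^sup>2 / 2}"

definition Tn_set ::
  "'a::euclidean_space measure \<Rightarrow> ('a \<Rightarrow> real) \<Rightarrow> ('a \<Rightarrow> real) \<Rightarrow> ('a \<Rightarrow> real) \<Rightarrow> ('a \<Rightarrow> real)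
    \<Rightarrow> 'a \<Rightarrow> (real \<times> 'a) set" where
  "Tn_set P fs gs fn gn y =
     {(l, x). l \<in> {0..1} \<and> x \<in> spt P \<and>
        l * (fs x + gs y) + (1 - l) * (fn x + gn y) \<ge> (norm (x - y))\<^sup>2 / 2}"

definition Ln_op ::
  "'a::euclidean_space measure \<Rightarrow> 'a measure \<Rightarrow> real \<Rightarrow> real \<Rightarrow> ('a \<Rightarrow> real) \<Rightarrow> ('a \<Rightarrow> real)
    \<Rightarrow> ('a \<Rightarrow> real) \<times> ('a \<Rightarrow> real)
    \<Rightarrow> ('a \<Rightarrow> real) \<times> ('a \<Rightarrow> real) \<Rightarrow> ('a \<Rightarrow> real) \<times> ('a \<Rightarrow> real)" where
  "Ln_op P Q \<epsilon> \<eta> fs gs = (\<lambda>(fn, gn) (f, g). proj_oplus P Q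
     (\<lambda>x. if x \<in> spt P
          then f x * (1 - \<eta> / \<epsilon> * measure (lborel \<Otimes>\<^sub>M Q) (Sn_set Q fs gs fn gn x))
               - \<eta> / \<epsilon> * (LINT z:Sn_set Q fs gs fn gn x|(lborel \<Otimes>\<^sub>M Q). g (snd z))
          else 0,
      \<lambda>y. if y \<in> spt Q
          then g y * (1 - \<eta> / \<epsilon> * measure (lborel \<Otimes>\<^sub>M P) (Tn_set P fs gs fn gn y))
               - \<eta> / \<epsilon> * (LINT z:Tn_set P fs gs fn gn y|(lborel \<Otimes>\<^sub>M P). f (snd z))
          else 0))"

end

theory Submission
  imports Defs "HOL-Complex_Analysis.Great_Picard"
begin

text \<open>
  Write \<open>s\<close> for the slack of \<open>(fs, gs)\<close> and \<open>s\<^sub>n\<close> for the slack of the \<open>n\<close>-th iterate.  At a point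
  \<open>(x, y)\<close> where \<open>s\<close> and \<open>s\<^sub>n\<close> are both nonnegative or both negative, so are all their convex combinations, and
  there the averaged operator and the limit operator use the same integrand.  Their difference
  therefore only sees the mismatch set, where the signs differ.  If all sections of the mismatch set
  have mass at most \<open>\<omega>\<close>, the Cauchy-Schwarz inequality bounds the operator norm of the difference by
  \<open>2 (\<eta> / \<epsilon>) \<surd>\<omega>\<close> (\<open>op_norm_le\<close>).  It remains to show that the sections of the mismatch set become
  uniformly small (\<open>mismatch_small\<close>).

  Two facts give this.  First, a gradient step with \<open>\<eta> < \<epsilon>\<close> does not increase the \<open>L\<^sup>2\<close> distance to
  \<open>(fs, gs)\<close>, and the decrease of its square controls the squared \<open>L\<^sup>2\<close> distance between the positive
  parts of \<open>s\<^sub>n\<close> and \<open>s\<close> (\<open>energy_step\<close>); hence these positive parts converge.  The iterates stay Lipschitz with one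
  constant (\<open>gd_step_lipschitz\<close>) and are bounded, so by the Arzela-Ascoli theorem every subsequence
  has a further subsequence that converges uniformly, and the slack \<open>s'\<close> of the limit has the same
  positive part as \<open>s\<close> (\<open>subsequence_limit\<close>).  Only the positive part enters the optimality conditions,
  so the limit is again an optimal dual pair.  Where neither \<open>s\<close> nor \<open>s'\<close> is close to zero, \<open>s\<close>, \<open>s'\<close>
  and then \<open>s\<^sub>n\<close> have the same sign.  The argument thus identifies the positive part of the limiting
  slack, rather than the limiting pair itself.

  Second, for an optimal dual pair the set of \<open>y\<close> with zero slack at \<open>(x, y)\<close> lies in the frontier of
  a convex set (\<open>zero_slack_null\<close>).  So it is a null set, and by compactness the set where the slack
  is at most \<open>\<delta>\<close> in absolute value has small mass for small \<open>\<delta>\<close>, uniformly in \<open>x\<close>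
  (\<open>small_near_zero_set\<close>).

  The two marginals play symmetric roles; each one-sided statement is proved for \<open>(P, Q)\<close> and used
  for \<open>(Q, P)\<close> as well.
\<close>

section \<open>Square-integrable functions and the averaged gradient step\<close>

lemma integral_Cauchy_Schwarz:
  fixes u v :: "'a \<Rightarrow> real"
  assumes [measurable]: "u \<in> borel_measurable M" "v \<in> borel_measurable M"
    and u: "integrable M (\<lambda>x. (u x)\<^sup>2)" and v: "integrable M (\<lambda>x. (v x)\<^sup>2)"
  shows "integrable M (\<lambda>x. u x * v x)"
    and "(LINT x|M. u x * v x)\<^sup>2 \<le> (LINT x|M. (u x)\<^sup>2) * (LINT x|M. (v x)\<^sup>2)"
proof -
  show uv: "integrable M (\<lambda>x. u x * v x)"
  proof (rule Bochner_Integration.integrable_bound)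
    show "integrable M (\<lambda>x. (u x)\<^sup>2 + (v x)\<^sup>2)" using u v by simp
    have "\<bar>a * b\<bar> \<le> a\<^sup>2 + b\<^sup>2" for a b :: real
      using sum_squares_bound[of a b] sum_squares_bound[of a "-b"] by (auto simp: abs_if)
    then show "AE x in M. norm (u x * v x) \<le> norm ((u x)\<^sup>2 + (v x)\<^sup>2)" by simp
  qed simp
  define A B C where "A = (LINT x|M. (u x)\<^sup>2)" and "B = (LINT x|M. u x * v x)"
    and "C = (LINT x|M. (v x)\<^sup>2)"
  have quad: "0 \<le> t\<^sup>2 * A - 2 * t * B + C" for t
  proof -
    have "0 \<le> (LINT x|M. (t * u x - v x)\<^sup>2)" by simp
    also have "(\<lambda>x. (t * u x - v x)\<^sup>2) = (\<lambda>x. t\<^sup>2 * (u x)\<^sup>2 - 2 * t * (u x * v x) + (v x)\<^sup>2)"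
      by (auto simp: power2_eq_square algebra_simps)
    also have "(LINT x|M. t\<^sup>2 * (u x)\<^sup>2 - 2 * t * (u x * v x) + (v x)\<^sup>2) = t\<^sup>2 * A - 2 * t * B + C"
      using u v uv by (simp add: A_def B_def C_def)
    finally show ?thesis .
  qed
  have "0 \<le> A" by (simp add: A_def)
  have "B\<^sup>2 \<le> A * C"
  proof (cases "A = 0")
    case True
    have "B = 0"
    proof (rule ccontr)
      assume "B \<noteq> 0"
      then show False using quad[of "(C + 1) / (2 * B)"] True by simp
    qed
    then show ?thesis using True by simp
  next
    case False
    then show ?thesis using quad[of "B / A"] \<open>0 \<le> A\<close>
      by (simp add: field_simps power2_eq_square)
  qed
  then show "(LINT x|M. u x * v x)\<^sup>2 \<le> (LINT x|M. (u x)\<^sup>2) * (LINT x|M. (v x)\<^sup>2)"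
    by (simp add: A_def B_def C_def)
qed

lemma (in prob_space) integral_square_le:
  fixes h :: "'a \<Rightarrow> real"
  assumes "h \<in> borel_measurable M" "integrable M (\<lambda>x. (h x)\<^sup>2)"
  shows "(LINT x|M. h x)\<^sup>2 \<le> (LINT x|M. (h x)\<^sup>2)"
  using integral_Cauchy_Schwarz(2)[of "\<lambda>_. 1" M h] assms by (simp add: prob_space)

lemma (in prob_space) integrable_bounded:
  fixes h :: "'a \<Rightarrow> real"
  assumes "h \<in> borel_measurable M" "\<And>x. x \<in> space M \<Longrightarrow> \<bar>h x\<bar> \<le> B"
  shows "integrable M h"
  using assms by (intro integrable_const_bound[of _ B]) auto

text \<open>
  The one-step estimate behind the convergence of gradient descent.  Here \<open>a\<close> and \<open>b\<close> are the current
  errors of the two potentials and \<open>q\<close> is the error of the positive part of the slack.  By Jensen's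
  inequality the averages over the other marginal can be pulled out of the squares, so that all
  terms become integrals over the product space; there the claim is the pointwise inequality
  \<open>(a - \<theta> q)\<^sup>2 + (b - \<theta> q)\<^sup>2 \<le> a\<^sup>2 + b\<^sup>2 - 2 \<theta> (1 - \<theta>) q\<^sup>2\<close>, which follows from \<open>coercive\<close>.
\<close>
lemma fejer_step:
  fixes a :: "'a \<Rightarrow> real" and b :: "'b \<Rightarrow> real" and q :: "'a \<Rightarrow> 'b \<Rightarrow> real"
  assumes M: "prob_space M" and N: "prob_space N"
    and [measurable]: "a \<in> borel_measurable M" "b \<in> borel_measurable N"
      "case_prod q \<in> borel_measurable (M \<Otimes>\<^sub>M N)"
    and a: "\<And>x. x \<in> space M \<Longrightarrow> \<bar>a x\<bar> \<le> B" and b: "\<And>y. y \<in> space N \<Longrightarrow> \<bar>b y\<bar> \<le> B"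
    and q: "\<And>x y. x \<in> space M \<Longrightarrow> y \<in> space N \<Longrightarrow> \<bar>q x y\<bar> \<le> B"
    and coercive: "\<And>x y. x \<in> space M \<Longrightarrow> y \<in> space N \<Longrightarrow> (q x y)\<^sup>2 \<le> q x y * (a x + b y)"
    and \<theta>: "0 \<le> \<theta>"
  shows "(LINT x|M. (a x - \<theta> * (LINT y|N. q x y))\<^sup>2) + (LINT y|N. (b y - \<theta> * (LINT x|M. q x y))\<^sup>2)
    \<le> (LINT x|M. (a x)\<^sup>2) + (LINT y|N. (b y)\<^sup>2)
       - 2 * \<theta> * (1 - \<theta>) * (LINT z|(M \<Otimes>\<^sub>M N). (q (fst z) (snd z))\<^sup>2)"
proof -
  interpret M: prob_space M by fact
  interpret N: prob_space N by fact
  interpret MN: pair_prob_space M N ..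
  interpret NM: pair_prob_space N M ..
  let ?\<Pi> = "M \<Otimes>\<^sub>M N"
  have [measurable]: "(\<lambda>(y, x). q x y) \<in> borel_measurable (N \<Otimes>\<^sub>M M)"
    using measurable_compose[OF measurable_pair_swap' \<open>case_prod q \<in> _\<close>] by (simp add: case_prod_beta')
  have [measurable]: "(\<lambda>y. q x y) \<in> borel_measurable N" if "x \<in> space M" for x
    using measurable_Pair2[OF \<open>case_prod q \<in> _\<close> that] by simp
  have [measurable]: "(\<lambda>x. q x y) \<in> borel_measurable M" if "y \<in> space N" for y
    using measurable_Pair1[OF \<open>case_prod q \<in> _\<close> that] by simp
  have [measurable]: "(\<lambda>z. q (fst z) (snd z)) \<in> borel_measurable ?\<Pi>"
    using \<open>case_prod q \<in> _\<close> by (simp add: case_prod_beta')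
  have "0 \<le> B" using a M.not_empty by fastforce
  have sq: "r\<^sup>2 \<le> C\<^sup>2" if "\<bar>r\<bar> \<le> C" for r C :: real
    using that abs_le_square_iff[of r C] by linarith
  have ab: "\<bar>r - \<theta> * s\<bar> \<le> B + \<theta> * B" if "\<bar>r\<bar> \<le> B" "\<bar>s\<bar> \<le> B" for r s
  proof -
    have "\<bar>r - \<theta> * s\<bar> \<le> \<bar>r\<bar> + \<theta> * \<bar>s\<bar>" using abs_triangle_ineq4[of r "\<theta> * s"] \<theta> by (simp add: abs_mult)
    also have "\<dots> \<le> B + \<theta> * B" using that \<theta> by (intro add_mono mult_left_mono)
    finally show ?thesis .
  qed
  have sqab: "(r - \<theta> * s)\<^sup>2 \<le> (B + \<theta> * B)\<^sup>2" if "\<bar>r\<bar> \<le> B" "\<bar>s\<bar> \<le> B" for r s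
    using sq[OF ab[OF that]] .
  have iF: "integrable ?\<Pi> (\<lambda>z. (a (fst z) - \<theta> * q (fst z) (snd z))\<^sup>2)"
    by (rule MN.integrable_bounded[of _ "(B + \<theta> * B)\<^sup>2"])
       (auto simp: space_pair_measure intro!: sqab a q)
  have iG: "integrable ?\<Pi> (\<lambda>z. (b (snd z) - \<theta> * q (fst z) (snd z))\<^sup>2)"
    by (rule MN.integrable_bounded[of _ "(B + \<theta> * B)\<^sup>2"])
       (auto simp: space_pair_measure intro!: sqab b q)
  have ia: "integrable ?\<Pi> (\<lambda>z. (a (fst z))\<^sup>2)"
    by (rule MN.integrable_bounded[of _ "B\<^sup>2"])
       (auto simp: space_pair_measure intro!: sq a)
  have ib: "integrable ?\<Pi> (\<lambda>z. (b (snd z))\<^sup>2)"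
    by (rule MN.integrable_bounded[of _ "B\<^sup>2"])
       (auto simp: space_pair_measure intro!: sq b)
  have iq: "integrable ?\<Pi> (\<lambda>z. (q (fst z) (snd z))\<^sup>2)"
    by (rule MN.integrable_bounded[of _ "B\<^sup>2"])
       (auto simp: space_pair_measure intro!: sq q)
  have iqN: "integrable N (q x)" if "x \<in> space M" for x
    using that by (intro N.integrable_bounded[of _ B]) (auto intro: q)
  have iqM: "integrable M (\<lambda>x. q x y)" if "y \<in> space N" for y
    using that by (intro M.integrable_bounded[of _ B]) (auto intro: q)
  have "(LINT x|M. (a x - \<theta> * (LINT y|N. q x y))\<^sup>2) \<le> (LINT x|M. LINT y|N. (a x - \<theta> * q x y)\<^sup>2)"
  proof (rule integral_mono_AE')
    show "integrable M (\<lambda>x. LINT y|N. (a x - \<theta> * q x y)\<^sup>2)"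
      using MN.integrable_fst'[OF iF] by simp
    show "AE x in M. (a x - \<theta> * (LINT y|N. q x y))\<^sup>2 \<le> (LINT y|N. (a x - \<theta> * q x y)\<^sup>2)"
    proof (rule AE_I2)
      fix x assume x: "x \<in> space M"
      have "a x - \<theta> * (LINT y|N. q x y) = (LINT y|N. a x - \<theta> * q x y)"
        using iqN[OF x] by (simp add: N.prob_space)
      moreover have "integrable N (\<lambda>y. (a x - \<theta> * q x y)\<^sup>2)"
        using x by (intro N.integrable_bounded[of _ "(B + \<theta> * B)\<^sup>2"])
          (auto intro!: sqab a q)
      ultimately show "(a x - \<theta> * (LINT y|N. q x y))\<^sup>2 \<le> (LINT y|N. (a x - \<theta> * q x y)\<^sup>2)"
        using x by (simp only:) (intro N.integral_square_le; simp)
    qed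
  qed simp
  also have "\<dots> = (LINT z|?\<Pi>. (a (fst z) - \<theta> * q (fst z) (snd z))\<^sup>2)"
    using MN.integral_fst'[OF iF] by simp
  finally have 1: "(LINT x|M. (a x - \<theta> * (LINT y|N. q x y))\<^sup>2) \<le> \<dots>" .
  have "(LINT y|N. (b y - \<theta> * (LINT x|M. q x y))\<^sup>2) \<le> (LINT y|N. LINT x|M. (b y - \<theta> * q x y)\<^sup>2)"
  proof (rule integral_mono_AE')
    show "integrable N (\<lambda>y. LINT x|M. (b y - \<theta> * q x y)\<^sup>2)"
      using MN.integrable_snd[of "\<lambda>x y. (b y - \<theta> * q x y)\<^sup>2"] iG by (simp add: case_prod_beta')
    show "AE y in N. (b y - \<theta> * (LINT x|M. q x y))\<^sup>2 \<le> (LINT x|M. (b y - \<theta> * q x y)\<^sup>2)"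
    proof (rule AE_I2)
      fix y assume y: "y \<in> space N"
      have "b y - \<theta> * (LINT x|M. q x y) = (LINT x|M. b y - \<theta> * q x y)"
        using iqM[OF y] by (simp add: M.prob_space)
      moreover have "integrable M (\<lambda>x. (b y - \<theta> * q x y)\<^sup>2)"
        using y by (intro M.integrable_bounded[of _ "(B + \<theta> * B)\<^sup>2"])
          (auto intro!: sqab b q)
      ultimately show "(b y - \<theta> * (LINT x|M. q x y))\<^sup>2 \<le> (LINT x|M. (b y - \<theta> * q x y)\<^sup>2)"
        using y by (simp only:) (intro M.integral_square_le; simp)
    qed
  qed simp
  also have "\<dots> = (LINT z|?\<Pi>. (b (snd z) - \<theta> * q (fst z) (snd z))\<^sup>2)"
    using MN.integral_snd[of "\<lambda>x y. (b y - \<theta> * q x y)\<^sup>2"] iG by (simp add: case_prod_beta')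
  finally have 2: "(LINT y|N. (b y - \<theta> * (LINT x|M. q x y))\<^sup>2) \<le> \<dots>" .
  have "(LINT z|?\<Pi>. (a (fst z) - \<theta> * q (fst z) (snd z))\<^sup>2 + (b (snd z) - \<theta> * q (fst z) (snd z))\<^sup>2)
     \<le> (LINT z|?\<Pi>. (a (fst z))\<^sup>2 + (b (snd z))\<^sup>2 - 2 * \<theta> * (1 - \<theta>) * (q (fst z) (snd z))\<^sup>2)"
  proof (rule integral_mono)
    fix z assume "z \<in> space ?\<Pi>"
    then have "\<theta> * (q (fst z) (snd z))\<^sup>2 \<le> \<theta> * (q (fst z) (snd z) * (a (fst z) + b (snd z)))"
      using \<theta> by (intro mult_left_mono coercive) (auto simp: space_pair_measure)
    then show "(a (fst z) - \<theta> * q (fst z) (snd z))\<^sup>2 + (b (snd z) - \<theta> * q (fst z) (snd z))\<^sup>2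
      \<le> (a (fst z))\<^sup>2 + (b (snd z))\<^sup>2 - 2 * \<theta> * (1 - \<theta>) * (q (fst z) (snd z))\<^sup>2"
      by (simp add: power2_eq_square algebra_simps)
  qed (use iF iG ia ib iq in auto)
  also have "\<dots> = (LINT z|?\<Pi>. (a (fst z))\<^sup>2) + (LINT z|?\<Pi>. (b (snd z))\<^sup>2)
      - 2 * \<theta> * (1 - \<theta>) * (LINT z|?\<Pi>. (q (fst z) (snd z))\<^sup>2)"
    using ia ib iq by simp
  also have "(LINT z|?\<Pi>. (a (fst z))\<^sup>2) = (LINT x|M. (a x)\<^sup>2)"
    using MN.integral_fst'[OF ia] by (simp add: N.prob_space)
  also have "(LINT z|?\<Pi>. (b (snd z))\<^sup>2) = (LINT y|N. (b y)\<^sup>2)"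
    using MN.integral_snd[of "\<lambda>x y. (b y)\<^sup>2"] ib by (simp add: case_prod_beta' M.prob_space)
  finally show ?thesis using 1 2 iF iG by simp
qed

section \<open>Probability measures with compact support\<close>

locale compactly_supported_prob = prob_space M
  for M :: "'a::euclidean_space measure" +
  assumes sets_borel: "sets M = sets borel"
    and compact_spt: "compact (spt M)"
begin

lemma space_UNIV: "space M = UNIV"
  using sets_eq_imp_space_eq[OF sets_borel] by simp

lemma closed_spt: "closed (spt M)"
  using compact_spt by (rule compact_imp_closed)

lemma spt_sets[measurable]: "spt M \<in> sets M"
  using closed_spt by (simp add: sets_borel)

text \<open>
  The complement of the support is a union of open null sets, and by the Lindelof property countably
  many of them suffice.
\<close>
lemma AE_spt: "AE x in M. x \<in> spt M"
proof -
  define \<U> where "\<U> = {U. open U \<and> emeasure M U = 0}"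
  obtain \<V> where \<V>: "\<V> \<subseteq> \<U>" "countable \<V>" "\<Union>\<V> = \<Union>\<U>"
    using Lindelof[of \<U>] by (auto simp: \<U>_def)
  have "\<Union>\<V> \<in> null_sets M"
  proof -
    have "(\<Union>U\<in>\<V>. U) \<in> null_sets M"
      using \<V>(1,2) by (intro null_sets_UN') (auto simp: \<U>_def null_sets_def sets_borel)
    then show ?thesis by simp
  qed
  moreover have "- spt M \<subseteq> \<Union>\<V>"
    unfolding \<V>(3) by (auto simp: spt_def \<U>_def)
  ultimately show ?thesis
    by (intro AE_I'[of "\<Union>\<V>"]) (auto simp: space_UNIV)
qed

lemma prob_spt: "prob (spt M) = 1"
  using AE_spt by (simp add: AE_in_set_eq_1)

text \<open>
  Potentials are only continuous on the support.  Restricting the measure to the support makes them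
  measurable and bounded on the whole space.
\<close>
definition on_spt :: "'a measure" where "on_spt = restrict_space M (spt M)"

lemma space_on_spt[simp]: "space on_spt = spt M"
  by (simp add: on_spt_def space_restrict_space space_UNIV)

lemma prob_space_on_spt: "prob_space on_spt"
  unfolding on_spt_def using prob_spt
  by (intro prob_space_restrict_space) (auto simp: emeasure_eq_measure)

lemma borel_measurable_on_spt:
  fixes f :: "'a \<Rightarrow> 'b::topological_space"
  assumes "continuous_on (spt M) f"
  shows "f \<in> borel_measurable on_spt"
  unfolding on_spt_def measurable_cong_sets[OF sets_restrict_space_cong[OF sets_borel] refl]
  using assms by (rule borel_measurable_continuous_on_restrict)

lemma integral_on_spt: "(LINT x:spt M|M. f x) = (LINT x|on_spt. f x :: real)"
  by (simp add: set_lebesgue_integral_def on_spt_def integral_restrict_space)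

lemma continuous_on_spt_bounded:
  fixes f :: "'a \<Rightarrow> real"
  assumes "continuous_on (spt M) f"
  obtains B where "0 \<le> B" "\<And>x. x \<in> spt M \<Longrightarrow> \<bar>f x\<bar> \<le> B"
proof -
  have "bounded (f ` spt M)"
    using compact_continuous_image[OF assms compact_spt] by (rule compact_imp_bounded)
  then obtain B where "\<And>x. x \<in> spt M \<Longrightarrow> \<bar>f x\<bar> \<le> B" by (auto simp: bounded_iff)
  then show ?thesis using that[of "\<bar>B\<bar>"] by fastforce
qed

lemma integrable_on_spt:
  fixes f :: "'a \<Rightarrow> real"
  assumes "continuous_on (spt M) f"
  shows "integrable on_spt f"
proof -
  obtain B where "\<And>x. x \<in> spt M \<Longrightarrow> \<bar>f x\<bar> \<le> B"
    using continuous_on_spt_bounded[OF assms] by blast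
  then show ?thesis
    using prob_space.integrable_bounded[OF prob_space_on_spt borel_measurable_on_spt[OF assms], of B] by simp
qed

text \<open>
  Every relatively open nonempty subset of the support has positive mass.
\<close>
lemma continuous_AE_zero:
  fixes \<phi> :: "'a \<Rightarrow> real"
  assumes cont: "continuous_on (spt M) \<phi>" and AE: "AE x in on_spt. \<phi> x = 0" and x: "x \<in> spt M"
  shows "\<phi> x = 0"
proof (rule ccontr)
  assume nz: "\<phi> x \<noteq> 0"
  obtain U where U: "open U" "U \<inter> spt M = \<phi> -` (- {0}) \<inter> spt M"
    using continuous_on_open_invariant[of "spt M" \<phi>] cont by (metis open_Compl closed_singleton)
  have "AE y in M. y \<in> spt M \<longrightarrow> \<phi> y = 0"
    using AE unfolding on_spt_def by (subst (asm) AE_restrict_space_iff) (auto simp: sets_borel closed_spt space_UNIV)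
  with AE_spt have "AE y in M. y \<notin> U"
    by eventually_elim (use U(2) in auto)
  then have "prob U = 0"
    using U(1) by (simp add: prob_eq_0 sets_borel)
  moreover have "x \<in> U" using U(2) x nz by auto
  ultimately show False
    using x U(1) by (auto simp: spt_def emeasure_eq_measure)
qed

end

section \<open>Slack functions\<close>

lemma slack_commute: "slack f g x y = slack g f y x"
  by (simp add: slack_def norm_minus_commute)

lemma continuous_on_slack:
  assumes "continuous_on A f" "continuous_on B g"
  shows "continuous_on (A \<times> B) (\<lambda>z. slack f g (fst z) (snd z))"
proof -
  have "continuous_on (A \<times> B) (\<lambda>z. f (fst z))"
    by (rule continuous_on_compose2[OF assms(1)]) (auto intro!: continuous_intros)
  moreover have "continuous_on (A \<times> B) (\<lambda>z. g (snd z))"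
    by (rule continuous_on_compose2[OF assms(2)]) (auto intro!: continuous_intros)
  ultimately show ?thesis unfolding slack_def by (intro continuous_intros) auto
qed

lemma continuous_on_slack_right: "continuous_on B g \<Longrightarrow> continuous_on B (slack f g x)"
  unfolding slack_def by (intro continuous_intros) auto

lemma continuous_on_slack_left: "continuous_on A f \<Longrightarrow> continuous_on A (\<lambda>x. slack f g x y)"
  unfolding slack_def by (intro continuous_intros) auto

text \<open>
  If the claim failed, there would be points \<open>X j\<close> at which the set \<open>\<bar>h\<bar> \<le> 1 / (j + 1)\<close> has mass at least
  \<open>e\<close>.  For a limit point \<open>x\<close>, uniform continuity puts these sets, for large \<open>j\<close>, into
  \<open>\<bar>h x\<bar> \<le> 1 / (k + 1)\<close>, for each \<open>k\<close>.  Letting \<open>k\<close> tend to infinity, the zero set of \<open>h x\<close> would have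
  mass at least \<open>e\<close>.
\<close>
lemma small_near_zero_set:
  fixes M :: "'b::euclidean_space measure" and h :: "'a::euclidean_space \<Rightarrow> 'b \<Rightarrow> real"
  assumes M: "finite_measure M" "sets M = sets borel"
    and A: "compact A" and B: "compact B"
    and cont: "continuous_on (A \<times> B) (\<lambda>z. h (fst z) (snd z))"
    and null: "\<And>x. x \<in> A \<Longrightarrow> measure M {y \<in> B. h x y = 0} = 0"
    and e: "0 < e"
  shows "\<exists>\<delta>>0. \<forall>x\<in>A. measure M {y \<in> B. \<bar>h x y\<bar> \<le> \<delta>} < e"
proof (rule ccontr)
  interpret finite_measure M by fact
  define D where "D \<delta> x = {y \<in> B. \<bar>h x y\<bar> \<le> \<delta>}" for \<delta> x
  have contx: "continuous_on B (h x)" if "x \<in> A" for x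
  proof -
    have "continuous_on B (\<lambda>y. h (fst (x, y)) (snd (x, y)))"
      by (rule continuous_on_compose2[OF cont]) (use that in \<open>auto intro!: continuous_intros\<close>)
    then show ?thesis by simp
  qed
  have D_sets[measurable]: "D \<delta> x \<in> sets M" if "x \<in> A" for \<delta> x
  proof -
    have "closed (D \<delta> x)" unfolding D_def
      using contx[OF that] by (intro continuous_on_closed_Collect_le compact_imp_closed[OF B] continuous_intros)
        (auto)
    then show ?thesis by (simp add: M(2))
  qed
  assume "\<not> ?thesis"
  then have "\<exists>x\<in>A. e \<le> measure M (D (1 / Suc j) x)" for j :: nat
    by (force simp: D_def not_less)
  then obtain X where X: "X j \<in> A" "e \<le> measure M (D (1 / Suc j) (X j))" for j :: nat
    by metis
  obtain x r where x: "x \<in> A" and r: "strict_mono r" and lim: "(X \<circ> r) \<longlonglongrightarrow> x"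
    using A X(1) unfolding compact_def by blast
  have bound: "e \<le> measure M (D (1 / Suc k) x)" for k
  proof -
    define H where "H z = h (fst z) (snd z)" for z
    have "uniformly_continuous_on (A \<times> B) H"
      using cont A B unfolding H_def by (intro compact_uniformly_continuous compact_Times)
    moreover have "0 < 1 / (2 * real (Suc k))" by simp
    ultimately obtain d where d: "d > 0" "\<forall>z\<in>A \<times> B. \<forall>z'\<in>A \<times> B. dist z' z < d \<longrightarrow>
        dist (H z') (H z) < 1 / (2 * real (Suc k))"
      unfolding uniformly_continuous_on_def by meson
    have "\<forall>\<^sub>F j in sequentially. dist (X (r j)) x < d"
      using lim d(1) by (auto simp: tendsto_iff)
    moreover have "\<forall>\<^sub>F j in sequentially. 2 * Suc k \<le> j"
      by (rule eventually_ge_at_top)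
    ultimately have "\<forall>\<^sub>F j in sequentially. dist (X (r j)) x < d \<and> 2 * Suc k \<le> j"
      by (rule eventually_conj)
    then obtain j where j: "dist (X (r j)) x < d" "2 * Suc k \<le> j"
      using eventually_happens'[OF sequentially_bot] by blast
    have "2 * Suc k \<le> r j" using j(2) seq_suble[OF r, of j] by linarith
    then have rj: "1 / Suc (r j) \<le> 1 / (2 * real (Suc k))"
      by (intro frac_le) auto
    have "D (1 / Suc (r j)) (X (r j)) \<subseteq> D (1 / Suc k) x"
    proof
      fix y assume y: "y \<in> D (1 / Suc (r j)) (X (r j))"
      then have "\<bar>h (X (r j)) y - h x y\<bar> < 1 / (2 * real (Suc k))"
        using d(2)[rule_format, of "(x, y)" "(X (r j), y)"] x X(1) j(1)
        by (simp add: D_def H_def dist_Pair_Pair dist_real_def)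
      moreover have "\<bar>h (X (r j)) y\<bar> \<le> 1 / (2 * real (Suc k))" using y rj by (auto simp: D_def)
      ultimately have "\<bar>h x y\<bar> \<le> 1 / (2 * real (Suc k)) + 1 / (2 * real (Suc k))" by linarith
      also have "\<dots> = 1 / Suc k" by (simp add: field_simps)
      finally show "y \<in> D (1 / Suc k) x" using y by (auto simp: D_def)
    qed
    then have "measure M (D (1 / Suc (r j)) (X (r j))) \<le> measure M (D (1 / Suc k) x)"
      by (intro finite_measure_mono D_sets x)
    with X(2)[of "r j"] show ?thesis by linarith
  qed
  have "(\<lambda>k. measure M (D (1 / Suc k) x)) \<longlonglongrightarrow> measure M (\<Inter>k. D (1 / Suc k) x)"
  proof (rule finite_Lim_measure_decseq)
    show "decseq (\<lambda>k. D (1 / real (Suc k)) x)"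
    proof (rule decseq_SucI)
      fix k
      have "1 / real (Suc (Suc k)) \<le> 1 / real (Suc k)" by (simp add: frac_le)
      then show "D (1 / real (Suc (Suc k))) x \<subseteq> D (1 / real (Suc k)) x" by (auto simp: D_def)
    qed
  qed (use x D_sets in auto)
  moreover have "(\<Inter>k. D (1 / Suc k) x) = {y \<in> B. h x y = 0}"
  proof -
    have "h x y = 0" if "\<And>k::nat. \<bar>h x y\<bar> \<le> 1 / Suc k" for y
    proof (rule ccontr)
      assume "h x y \<noteq> 0"
      then obtain k :: nat where "inverse (real (Suc k)) < \<bar>h x y\<bar>"
        using reals_Archimedean[of "\<bar>h x y\<bar>"] by auto
      with that[of k] show False by (simp add: inverse_eq_divide)
    qed
    then show ?thesis by (auto simp: D_def)
  qed
  ultimately have "(\<lambda>k. measure M (D (1 / Suc k) x)) \<longlonglongrightarrow> 0" using null[OF x] by simp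
  then have "e \<le> 0" using bound by (intro LIMSEQ_le_const) auto
  with e show False by simp
qed

text \<open>
  The difference of two slacks with the same second argument is affine in that argument, and the
  potential \<open>g\<close> drops out.  This is the source of all convexity below.
\<close>
lemma slack_diff:
  "slack f g x' y - slack f g x y = f x' - f x + inner (x' - x) y + ((norm x)\<^sup>2 - (norm x')\<^sup>2) / 2"
  for x x' y :: "'a::real_inner"
  unfolding slack_def power2_norm_eq_inner
  by (simp add: inner_diff inner_commute field_simps)

lemma slack_left_lipschitz:
  fixes x x' y :: "'a::real_inner"
  assumes "norm (x - y) \<le> K" "norm (x' - y) \<le> K"
  shows "f x - f x' - K * dist x x' \<le> slack f g x y - slack f g x' y"
proof -
  have "(norm (x - y))\<^sup>2 - (norm (x' - y))\<^sup>2 = (norm (x - y) - norm (x' - y)) * (norm (x - y) + norm (x' - y))"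
    by (simp add: power2_eq_square algebra_simps)
  also have "\<dots> \<le> dist x x' * (K + K)"
  proof (rule mult_mono)
    show "norm (x - y) - norm (x' - y) \<le> dist x x'"
      using norm_triangle_ineq2[of "x - y" "x' - y"] by (simp add: dist_norm)
  qed (use assms in auto)
  finally show ?thesis by (simp add: slack_def algebra_simps)
qed

section \<open>Optimal dual pairs and the gradient step\<close>

text \<open>
  The optimality conditions by themselves, without the normalization of the means: in this form they
  are symmetric in the marginals and depend on the pair only through the positive part of its slack.
\<close>
definition solves_dual ::
  "'a::euclidean_space measure \<Rightarrow> 'a measure \<Rightarrow> real \<Rightarrow> ('a \<Rightarrow> real) \<Rightarrow> ('a \<Rightarrow> real) \<Rightarrow> bool" where
  "solves_dual P Q \<epsilon> f g \<longleftrightarrow>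
     continuous_on (spt P) f \<and> continuous_on (spt Q) g \<and>
     (\<forall>y\<in>spt Q. \<epsilon> = (LINT x:spt P|P. max (slack f g x y) 0)) \<and>
     (\<forall>x\<in>spt P. \<epsilon> = (LINT y:spt Q|Q. max (slack f g x y) 0))"

lemma solves_dual_commute: "solves_dual P Q \<epsilon> f g \<longleftrightarrow> solves_dual Q P \<epsilon> g f"
  unfolding solves_dual_def by (subst (1 2) slack_commute) auto

text \<open>
  One component of the gradient step; the component for the other marginal is the same function with
  the roles exchanged.
\<close>
definition gd_step ::
  "'a::euclidean_space measure \<Rightarrow> real \<Rightarrow> real \<Rightarrow> ('a \<Rightarrow> real) \<Rightarrow> ('a \<Rightarrow> real) \<Rightarrow> 'a \<Rightarrow> real" where
  "gd_step Q \<epsilon> \<eta> f g x = f x + \<eta> * (1 - 1 / \<epsilon> * (LINT y:spt Q|Q. max (slack f g x y) 0))"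

lemma gd_iter_Suc:
  "gd_iter P Q \<epsilon> \<eta> f0 g0 (Suc n) =
     (gd_step Q \<epsilon> \<eta> (fst (gd_iter P Q \<epsilon> \<eta> f0 g0 n)) (snd (gd_iter P Q \<epsilon> \<eta> f0 g0 n)),
      gd_step P \<epsilon> \<eta> (snd (gd_iter P Q \<epsilon> \<eta> f0 g0 n)) (fst (gd_iter P Q \<epsilon> \<eta> f0 g0 n)))"
  by (simp add: gd_step_def[abs_def] case_prod_beta' Let_def slack_commute[of "snd _" "fst _"])

locale qot = P: compactly_supported_prob P + Q: compactly_supported_prob Q
  for P Q :: "'a::euclidean_space measure" +
  fixes \<epsilon> :: real
  assumes eps: "0 < \<epsilon>"
begin

lemma swap: "qot Q P \<epsilon>"
  by unfold_locales (rule eps)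

text \<open>
  The function \<open>H y = \<integral> (s(x', y) - s(x, y))\<^sub>+ dP(x') - \<epsilon>\<close> is convex on the whole space, because the
  integrand is the positive part of an affine function of \<open>y\<close>.  On the support of \<open>Q\<close> the optimality
  condition makes \<open>H\<close> vanish where \<open>s(x, y) = 0\<close> and makes it negative where \<open>s(x, y) > 0\<close>; the latter
  happens somewhere since \<open>s(x, \<cdot>)\<^sub>+\<close> has integral \<open>\<epsilon> > 0\<close>.  A zero of a convex function that is
  negative somewhere cannot be interior to the sublevel set \<open>H \<le> 0\<close>: continuing the segment
  from the negative point beyond the zero would lead to positive values.
\<close>
lemma zero_slack_null:
  assumes sol: "solves_dual P Q \<epsilon> f g" and x: "x \<in> spt P"
    and frontier: "\<And>C. convex C \<Longrightarrow> measure Q (frontier C) = 0"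
  shows "measure Q {y \<in> spt Q. slack f g x y = 0} = 0"
proof -
  have f: "continuous_on (spt P) f" and g: "continuous_on (spt Q) g"
    and eqP: "\<And>y. y \<in> spt Q \<Longrightarrow> (LINT x|P.on_spt. max (slack f g x y) 0) = \<epsilon>"
    and eqQ: "\<And>x. x \<in> spt P \<Longrightarrow> (LINT y|Q.on_spt. max (slack f g x y) 0) = \<epsilon>"
    using sol by (auto simp: solves_dual_def P.integral_on_spt Q.integral_on_spt)
  interpret P': prob_space P.on_spt by (rule P.prob_space_on_spt)
  define \<phi> where "\<phi> x' y = f x' - f x + inner (x' - x) y + ((norm x)\<^sup>2 - (norm x')\<^sup>2) / 2" for x' y
  define H where "H y = (LINT x'|P.on_spt. max (\<phi> x' y) 0) - \<epsilon>" for y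
  have \<phi>: "\<phi> x' y = slack f g x' y - slack f g x y" for x' y
    by (simp add: \<phi>_def slack_diff)
  have int: "integrable P.on_spt (\<lambda>x'. max (\<phi> x' y) 0)" for y
    unfolding \<phi>_def by (intro P.integrable_on_spt continuous_intros f) simp
  have conv: "H ((1 - t) *\<^sub>R u + t *\<^sub>R v) \<le> (1 - t) * H u + t * H v" if t: "0 \<le> t" "t \<le> 1" for t u v
  proof -
    have "(LINT x'|P.on_spt. max (\<phi> x' ((1 - t) *\<^sub>R u + t *\<^sub>R v)) 0)
        \<le> (LINT x'|P.on_spt. (1 - t) * max (\<phi> x' u) 0 + t * max (\<phi> x' v) 0)"
    proof (rule integral_mono)
      fix x'
      define c where "c = f x' - f x + ((norm x)\<^sup>2 - (norm x')\<^sup>2) / 2"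
      have "\<phi> x' w = c + inner (x' - x) w" for w by (simp add: \<phi>_def c_def)
      then have "\<phi> x' ((1 - t) *\<^sub>R u + t *\<^sub>R v) = (1 - t) * \<phi> x' u + t * \<phi> x' v"
        by (simp only: inner_add_right inner_scaleR_right) (simp add: algebra_simps)
      also have "\<dots> \<le> (1 - t) * max (\<phi> x' u) 0 + t * max (\<phi> x' v) 0"
        using t by (intro add_mono mult_left_mono) auto
      finally show "max (\<phi> x' ((1 - t) *\<^sub>R u + t *\<^sub>R v)) 0 \<le> (1 - t) * max (\<phi> x' u) 0 + t * max (\<phi> x' v) 0"
        using t by (auto intro!: add_nonneg_nonneg mult_nonneg_nonneg)
    qed (use int in auto)
    also have "\<dots> = (1 - t) * (H u + \<epsilon>) + t * (H v + \<epsilon>)"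
      using int by (simp add: H_def)
    finally show ?thesis by (simp add: H_def algebra_simps)
  qed
  have H0: "H y = 0" if "y \<in> spt Q" "slack f g x y = 0" for y
    using that eqP by (simp add: H_def \<phi>)
  obtain z where z: "z \<in> spt Q" "0 < slack f g x z"
  proof (rule ccontr)
    assume "\<not> thesis"
    then have "max (slack f g x y) 0 = 0" if "y \<in> spt Q" for y
      using \<open>\<And>z. z \<in> spt Q \<Longrightarrow> 0 < slack f g x z \<Longrightarrow> thesis\<close> that by force
    then have "(LINT y|Q.on_spt. max (slack f g x y) 0) = (LINT y|Q.on_spt. 0)"
      by (intro Bochner_Integration.integral_cong) auto
    with eqQ[OF x] eps show False by simp
  qed
  have Hz: "H z < 0"
  proof -
    define t where "t = slack f g x z"
    obtain B0 where B0: "0 \<le> B0" "\<And>x'. x' \<in> spt P \<Longrightarrow> \<bar>slack f g x' z\<bar> \<le> B0"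
      using P.continuous_on_spt_bounded[OF continuous_on_slack_left[OF f, of g z]] by blast
    \<comment> \<open>if \<open>s \<le> B\<close> and \<open>0 < t \<le> B\<close> then \<open>(s - t)\<^sub>+ \<le> (1 - t / B) s\<^sub>+\<close>, which makes the inequality strict\<close>
    define B where "B = max B0 t"
    have t: "0 < t" "t \<le> B" using z by (auto simp: t_def B_def)
    have "(LINT x'|P.on_spt. max (\<phi> x' z) 0) \<le> (LINT x'|P.on_spt. (1 - t / B) * max (slack f g x' z) 0)"
    proof (rule integral_mono)
      fix x' assume "x' \<in> space P.on_spt"
      then have "slack f g x' z \<le> B" using B0(2)[of x'] by (auto simp: B_def)
      then have "t * slack f g x' z \<le> t * B" using t by (intro mult_left_mono) auto
      then have "slack f g x' z - t \<le> (1 - t / B) * slack f g x' z" using t by (simp add: field_simps)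
      moreover have "(1 - t / B) * slack f g x' z \<le> (1 - t / B) * max (slack f g x' z) 0"
        using t by (intro mult_left_mono) auto
      moreover have "0 \<le> (1 - t / B) * max (slack f g x' z) 0"
        using t by (intro mult_nonneg_nonneg) auto
      ultimately show "max (\<phi> x' z) 0 \<le> (1 - t / B) * max (slack f g x' z) 0"
        unfolding \<phi> t_def[symmetric] by simp
    qed (use int in \<open>auto intro!: P.integrable_on_spt continuous_intros continuous_on_slack_left f\<close>)
    also have "\<dots> = (1 - t / B) * \<epsilon>" using eqP[OF z(1)] by simp
    also have "\<dots> < \<epsilon>" using t eps by simp
    finally show ?thesis by (simp add: H_def)
  qed
  define C where "C = {y. H y \<le> 0}"
  have "convex C"
    unfolding convex_alt C_def
  proof clarsimp
    fix u v and t :: real assume *: "H u \<le> 0" "H v \<le> 0" "0 \<le> t" "t \<le> 1"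
    then have "(1 - t) * H u \<le> 0" "t * H v \<le> 0" by (auto simp: mult_nonneg_nonpos)
    with conv[of t u v] * show "H ((1 - t) *\<^sub>R u + t *\<^sub>R v) \<le> 0" by linarith
  qed
  have "y \<in> frontier C" if y: "y \<in> spt Q" "slack f g x y = 0" for y
  proof -
    have "y \<notin> interior C"
    proof
      assume "y \<in> interior C"
      then obtain r where r: "r > 0" "cball y r \<subseteq> C"
        by (auto simp: mem_interior_cball)
      have "y \<noteq> z" using y z by auto
      \<comment> \<open>\<open>w\<close> continues the segment from \<open>z\<close> to \<open>y\<close> by the length \<open>r\<close>\<close>
      define \<tau> where "\<tau> = r / norm (y - z)"
      have \<tau>: "\<tau> > 0" using r \<open>y \<noteq> z\<close> by (simp add: \<tau>_def)
      define w where "w = y + \<tau> *\<^sub>R (y - z)"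
      have "w \<in> cball y r" using r \<open>y \<noteq> z\<close> by (simp add: w_def \<tau>_def dist_norm)
      with r have Hw: "H w \<le> 0" by (auto simp: C_def)
      define t where "t = \<tau> / (1 + \<tau>)"
      have t: "0 < t" "t < 1" using \<tau> by (auto simp: t_def)
      have "(1 + \<tau>) *\<^sub>R ((1 - t) *\<^sub>R w + t *\<^sub>R z) = (1 + \<tau>) *\<^sub>R y"
      proof -
        have "(1 + \<tau>) * (1 - t) = 1" "(1 + \<tau>) * t = \<tau>" using \<tau> by (auto simp: t_def field_simps)
        then have "(1 + \<tau>) *\<^sub>R ((1 - t) *\<^sub>R w + t *\<^sub>R z) = w + \<tau> *\<^sub>R z"
          by (simp only: scaleR_right_distrib scaleR_scaleR) simp
        then show ?thesis by (simp add: w_def algebra_simps)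
      qed
      then have "(1 - t) *\<^sub>R w + t *\<^sub>R z = y" using \<tau> by simp
      then have "H y \<le> (1 - t) * H w + t * H z" using conv[of t w z] t by simp
      moreover have "(1 - t) * H w \<le> 0" using t Hw by (simp add: mult_nonneg_nonpos)
      moreover have "t * H z < 0" using t Hz by (simp add: mult_pos_neg)
      ultimately show False using H0[OF y] by linarith
    qed
    moreover have "y \<in> C" using H0[OF y] by (simp add: C_def)
    ultimately show ?thesis using closure_subset by (auto simp: frontier_def)
  qed
  then have "measure Q {y \<in> spt Q. slack f g x y = 0} \<le> measure Q (frontier C)"
    by (intro Q.finite_measure_mono) (auto simp: Q.sets_borel)
  with frontier[OF \<open>convex C\<close>] show ?thesis by (simp add: measure_le_0_iff)
qed

text \<open>
  Let \<open>d = f x - f x'\<close> and \<open>\<Delta> = K * dist x x'\<close>, so that \<open>d \<le> \<Delta>\<close>.  The quadratic cost is \<open>K\<close>-Lipschitz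
  when \<open>K\<close> bounds the distances between the supports, so the increment of the slack is at least
  \<open>d - \<Delta>\<close>.  As this number is not positive, it also bounds the increment of the positive part from
  below.  With
  \<open>\<theta> = \<eta> / \<epsilon>\<close> the step therefore turns \<open>d\<close> into at most \<open>d - \<theta> (d - \<Delta>) = (1 - \<theta>) d + \<theta> \<Delta> \<le> \<Delta>\<close>.
\<close>
lemma gd_step_lipschitz:
  assumes f: "K-lipschitz_on (spt P) f" and g: "continuous_on (spt Q) g"
    and K: "\<And>x y. x \<in> spt P \<Longrightarrow> y \<in> spt Q \<Longrightarrow> norm (x - y) \<le> K"
    and \<eta>: "0 \<le> \<eta>" "\<eta> \<le> \<epsilon>"
  shows "K-lipschitz_on (spt P) (gd_step Q \<epsilon> \<eta> f g)"
proof (rule lipschitz_onI)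
  show "0 \<le> K" using f by (rule lipschitz_on_nonneg)
  interpret Q': prob_space Q.on_spt by (rule Q.prob_space_on_spt)
  have int: "integrable Q.on_spt (\<lambda>y. max (slack f g x y) 0)" for x
    by (intro Q.integrable_on_spt continuous_intros continuous_on_slack_right g)
  have *: "gd_step Q \<epsilon> \<eta> f g x - gd_step Q \<epsilon> \<eta> f g x' \<le> K * dist x x'"
    if x: "x \<in> spt P" "x' \<in> spt P" for x x'
  proof -
    define d where "d = f x - f x'"
    have d: "d \<le> K * dist x x'"
      using lipschitz_onD[OF f x] by (simp add: d_def dist_real_def)
    define I where "I x = (LINT y|Q.on_spt. max (slack f g x y) 0)" for x
    have "d - K * dist x x' = (LINT y|Q.on_spt. d - K * dist x x')"
      using Q'.prob_space by simp
    also have "\<dots> \<le> (LINT y|Q.on_spt. max (slack f g x y) 0 - max (slack f g x' y) 0)"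
    proof (rule integral_mono)
      fix y assume "y \<in> space Q.on_spt"
      then have "d - K * dist x x' \<le> slack f g x y - slack f g x' y"
        unfolding d_def by (intro slack_left_lipschitz K x) simp_all
      with d show "d - K * dist x x' \<le> max (slack f g x y) 0 - max (slack f g x' y) 0" by linarith
    qed (use int in auto)
    also have "\<dots> = I x - I x'" using int by (simp add: I_def)
    finally have I: "d - K * dist x x' \<le> I x - I x'" .
    have \<theta>: "0 \<le> \<eta> / \<epsilon>" "\<eta> / \<epsilon> \<le> 1" using \<eta> eps by auto
    have "gd_step Q \<epsilon> \<eta> f g x - gd_step Q \<epsilon> \<eta> f g x' = d - \<eta> / \<epsilon> * (I x - I x')"
      by (simp add: gd_step_def Q.integral_on_spt I_def d_def algebra_simps diff_divide_distrib)
    also have "\<dots> \<le> d - \<eta> / \<epsilon> * (d - K * dist x x')"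
      using mult_left_mono[OF I \<theta>(1)] by linarith
    also have "\<dots> = K * dist x x' - (1 - \<eta> / \<epsilon>) * (K * dist x x' - d)"
      by (simp add: algebra_simps)
    also have "\<dots> \<le> K * dist x x'" using \<theta> d by simp
    finally show ?thesis .
  qed
  fix x x' assume "x \<in> spt P" "x' \<in> spt P"
  then show "dist (gd_step Q \<epsilon> \<eta> f g x) (gd_step Q \<epsilon> \<eta> f g x') \<le> K * dist x x'"
    using *[of x x'] *[of x' x] by (simp add: dist_real_def dist_commute abs_le_iff)
qed

end

section \<open>Convergence of gradient descent\<close>

text \<open>
  The positive part is firmly nonexpansive; this provides the coercivity in the one-step estimate.
\<close>
lemma pos_part_monotone:
  fixes s t :: real
  shows "(max s 0 - max t 0)\<^sup>2 \<le> (max s 0 - max t 0) * (s - t)"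
proof (cases "s \<ge> 0"; cases "t \<ge> 0")
  assume "s \<ge> 0" "\<not> t \<ge> 0"
  then have "s * t \<le> 0" by (simp add: mult_nonneg_nonpos)
  then show ?thesis using \<open>s \<ge> 0\<close> \<open>\<not> t \<ge> 0\<close> by (simp add: max_def power2_eq_square algebra_simps)
next
  assume "\<not> s \<ge> 0" "t \<ge> 0"
  then have "t * s \<le> 0" by (simp add: mult_nonneg_nonpos)
  then show ?thesis using \<open>t \<ge> 0\<close> \<open>\<not> s \<ge> 0\<close> by (simp add: max_def power2_eq_square algebra_simps)
qed (auto simp: power2_eq_square max_def)

lemma gd_iter_swap: "gd_iter Q P \<epsilon> \<eta> g0 f0 n = prod.swap (gd_iter P Q \<epsilon> \<eta> f0 g0 n)"
  by (induction n) (simp_all only: gd_iter_Suc gd_iter.simps(1) fst_swap snd_swap swap_simp)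

text \<open>
  The constant \<open>K\<close> bounds the initial Lipschitz constants and the distances between the supports, so it
  is a common Lipschitz constant of all iterates.
\<close>
locale qot_descent = qot P Q \<epsilon> for P Q :: "'a::euclidean_space measure" and \<epsilon> +
  fixes \<eta> K :: real and fs gs f0 g0 :: "'a \<Rightarrow> real"
  assumes eta: "0 < \<eta>" "\<eta> < \<epsilon>"
    and sol: "solves_dual P Q \<epsilon> fs gs"
    and dist_le: "\<And>x y. x \<in> spt P \<Longrightarrow> y \<in> spt Q \<Longrightarrow> norm (x - y) \<le> K"
    and f0: "K-lipschitz_on (spt P) f0"
    and g0: "K-lipschitz_on (spt Q) g0"
begin

lemma dist_le': "y \<in> spt Q \<Longrightarrow> x \<in> spt P \<Longrightarrow> norm (y - x) \<le> K"
  using dist_le[of x y] by (simp add: norm_minus_commute)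

lemma swap_descent: "qot_descent Q P \<epsilon> \<eta> K gs fs g0 f0"
proof -
  interpret sw: qot Q P \<epsilon> by (rule swap)
  show ?thesis
    by unfold_locales
      (use eta sol dist_le f0 g0 in \<open>auto simp: solves_dual_commute[of Q] dist_le'\<close>)
qed

definition F where "F n = fst (gd_iter P Q \<epsilon> \<eta> f0 g0 n)"
definition G where "G n = snd (gd_iter P Q \<epsilon> \<eta> f0 g0 n)"

lemma F_Suc: "F (Suc n) = gd_step Q \<epsilon> \<eta> (F n) (G n)"
  and G_Suc: "G (Suc n) = gd_step P \<epsilon> \<eta> (G n) (F n)"
  by (simp_all only: F_def G_def gd_iter_Suc fst_conv snd_conv)

lemma iterates_lipschitz: "K-lipschitz_on (spt P) (F n) \<and> K-lipschitz_on (spt Q) (G n)"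
proof (induction n)
  case 0
  show ?case using f0 g0 by (simp add: F_def G_def)
next
  case (Suc n)
  interpret sw: qot Q P \<epsilon> by (rule swap)
  show ?case unfolding F_Suc G_Suc
    using Suc eta
    by (intro conjI gd_step_lipschitz sw.gd_step_lipschitz lipschitz_on_continuous_on[of K])
      (auto simp: dist_le dist_le')
qed

lemma continuous_F: "continuous_on (spt P) (F n)" and continuous_G: "continuous_on (spt Q) (G n)"
  using iterates_lipschitz[of n] by (auto intro: lipschitz_on_continuous_on)

lemma continuous_fs: "continuous_on (spt P) fs" and continuous_gs: "continuous_on (spt Q) gs"
  using sol by (auto simp: solves_dual_def)

abbreviation PQ where "PQ \<equiv> P.on_spt \<Otimes>\<^sub>M Q.on_spt"

definition energy where
  "energy f g = (LINT x|P.on_spt. (f x - fs x)\<^sup>2) + (LINT y|Q.on_spt. (g y - gs y)\<^sup>2)"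

definition excess where
  "excess f g x y = max (slack f g x y) 0 - max (slack fs gs x y) 0"

lemma excess_measurable:
  assumes f: "continuous_on (spt P) f" and g: "continuous_on (spt Q) g"
  shows "(\<lambda>z. excess f g (fst z) (snd z)) \<in> borel_measurable PQ"
proof -
  have [measurable]: "f \<in> borel_measurable P.on_spt" "fs \<in> borel_measurable P.on_spt"
     "g \<in> borel_measurable Q.on_spt" "gs \<in> borel_measurable Q.on_spt"
    using f g continuous_fs continuous_gs by (auto intro: P.borel_measurable_on_spt Q.borel_measurable_on_spt)
  have [measurable]: "fst \<in> borel_measurable PQ" "snd \<in> borel_measurable PQ"
    by (rule measurable_compose[OF measurable_fst P.borel_measurable_on_spt[OF continuous_on_id]],
        rule measurable_compose[OF measurable_snd Q.borel_measurable_on_spt[OF continuous_on_id]])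
  show ?thesis unfolding excess_def slack_def by measurable
qed

lemma excess_bounded:
  assumes f: "continuous_on (spt P) f" and g: "continuous_on (spt Q) g"
  obtains B where "\<And>x y. x \<in> spt P \<Longrightarrow> y \<in> spt Q \<Longrightarrow> \<bar>excess f g x y\<bar> \<le> B"
proof -
  have "continuous_on (spt P \<times> spt Q) (\<lambda>z. excess f g (fst z) (snd z))"
    unfolding excess_def using f g continuous_fs continuous_gs
    by (intro continuous_intros continuous_on_slack)
  then have "bounded ((\<lambda>z. excess f g (fst z) (snd z)) ` (spt P \<times> spt Q))"
    using P.compact_spt Q.compact_spt
    by (intro compact_imp_bounded compact_continuous_image compact_Times)
  then obtain B where "\<forall>x\<in>spt P. \<forall>y\<in>spt Q. \<bar>excess f g x y\<bar> \<le> B"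
    by (auto simp: bounded_iff)
  then show ?thesis using that[of B] by blast
qed

lemma energy_step:
  assumes f: "continuous_on (spt P) f" and g: "continuous_on (spt Q) g"
  shows "energy (gd_step Q \<epsilon> \<eta> f g) (gd_step P \<epsilon> \<eta> g f)
    \<le> energy f g - 2 * (\<eta> / \<epsilon>) * (1 - \<eta> / \<epsilon>) * (LINT z|PQ. (excess f g (fst z) (snd z))\<^sup>2)"
proof -
  have int: "integrable Q.on_spt (\<lambda>y. max (slack f g x y) 0)"
    "integrable Q.on_spt (\<lambda>y. max (slack fs gs x y) 0)"
    "integrable P.on_spt (\<lambda>x. max (slack f g x y) 0)"
    "integrable P.on_spt (\<lambda>x. max (slack fs gs x y) 0)" for x y
    using f g continuous_fs continuous_gs
    by (auto intro!: P.integrable_on_spt Q.integrable_on_spt continuous_intros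
        continuous_on_slack_left continuous_on_slack_right)
  obtain B1 where B1: "0 \<le> B1" "\<And>x. x \<in> spt P \<Longrightarrow> \<bar>f x - fs x\<bar> \<le> B1"
    using P.continuous_on_spt_bounded[OF continuous_on_diff[OF f continuous_fs]] by blast
  obtain B2 where B2: "0 \<le> B2" "\<And>y. y \<in> spt Q \<Longrightarrow> \<bar>g y - gs y\<bar> \<le> B2"
    using Q.continuous_on_spt_bounded[OF continuous_on_diff[OF g continuous_gs]] by blast
  obtain B3 where B3: "\<And>x y. x \<in> spt P \<Longrightarrow> y \<in> spt Q \<Longrightarrow> \<bar>excess f g x y\<bar> \<le> B3"
    using excess_bounded[OF f g] by blast
  define B where "B = max B1 (max B2 B3)"
  have step_eq: "c + \<eta> * (1 - 1 / \<epsilon> * J) - d = c - d - \<eta> / \<epsilon> * (J - \<epsilon>)" for c d J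
    using eps by (simp add: field_simps)
  have "(LINT x|P.on_spt. ((f x - fs x) - (\<eta> / \<epsilon>) * (LINT y|Q.on_spt. excess f g x y))\<^sup>2)
      + (LINT y|Q.on_spt. ((g y - gs y) - (\<eta> / \<epsilon>) * (LINT x|P.on_spt. excess f g x y))\<^sup>2)
    \<le> (LINT x|P.on_spt. (f x - fs x)\<^sup>2) + (LINT y|Q.on_spt. (g y - gs y)\<^sup>2)
       - 2 * (\<eta> / \<epsilon>) * (1 - \<eta> / \<epsilon>) * (LINT z|PQ. (excess f g (fst z) (snd z))\<^sup>2)"
  proof (rule fejer_step[OF P.prob_space_on_spt Q.prob_space_on_spt, where B = B])
    show "case_prod (excess f g) \<in> borel_measurable PQ"
      using excess_measurable[OF f g] by (simp add: case_prod_beta')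
    show "\<bar>excess f g x y\<bar> \<le> B" if "x \<in> space P.on_spt" "y \<in> space Q.on_spt" for x y
      using B3[of x y] that by (simp add: B_def)
    show "(excess f g x y)\<^sup>2 \<le> excess f g x y * (f x - fs x + (g y - gs y))" for x y
      using pos_part_monotone[of "slack f g x y" "slack fs gs x y"]
      by (simp add: excess_def slack_def algebra_simps)
    show "\<bar>f x - fs x\<bar> \<le> B" if "x \<in> space P.on_spt" for x
      using B1(2)[of x] that by (simp add: B_def)
    show "\<bar>g y - gs y\<bar> \<le> B" if "y \<in> space Q.on_spt" for y
      using B2(2)[of y] that by (simp add: B_def)
  qed (use f g continuous_fs continuous_gs eta eps in
      \<open>auto intro!: P.borel_measurable_on_spt Q.borel_measurable_on_spt continuous_intros\<close>)
  also have "(LINT x|P.on_spt. ((f x - fs x) - (\<eta> / \<epsilon>) * (LINT y|Q.on_spt. excess f g x y))\<^sup>2)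
      = (LINT x|P.on_spt. (gd_step Q \<epsilon> \<eta> f g x - fs x)\<^sup>2)"
  proof (rule Bochner_Integration.integral_cong[OF refl])
    fix x assume "x \<in> space P.on_spt"
    then have *: "(LINT y|Q.on_spt. max (slack fs gs x y) 0) = \<epsilon>"
      using sol by (simp add: solves_dual_def Q.integral_on_spt)
    show "((f x - fs x) - (\<eta> / \<epsilon>) * (LINT y|Q.on_spt. excess f g x y))\<^sup>2 = (gd_step Q \<epsilon> \<eta> f g x - fs x)\<^sup>2"
    proof -
      have "(LINT y|Q.on_spt. excess f g x y) = (LINT y:spt Q|Q. max (slack f g x y) 0) - \<epsilon>"
        using int * by (simp add: excess_def[abs_def] Q.integral_on_spt)
      then show ?thesis by (simp only: gd_step_def step_eq)
    qed
  qed
  also have "(LINT y|Q.on_spt. ((g y - gs y) - (\<eta> / \<epsilon>) * (LINT x|P.on_spt. excess f g x y))\<^sup>2)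
      = (LINT y|Q.on_spt. (gd_step P \<epsilon> \<eta> g f y - gs y)\<^sup>2)"
  proof (rule Bochner_Integration.integral_cong[OF refl])
    fix y assume "y \<in> space Q.on_spt"
    then have *: "(LINT x|P.on_spt. max (slack fs gs x y) 0) = \<epsilon>"
      using sol by (simp add: solves_dual_def P.integral_on_spt)
    show "((g y - gs y) - (\<eta> / \<epsilon>) * (LINT x|P.on_spt. excess f g x y))\<^sup>2 = (gd_step P \<epsilon> \<eta> g f y - gs y)\<^sup>2"
    proof -
      have "(LINT x|P.on_spt. excess f g x y) = (LINT x:spt P|P. max (slack f g x y) 0) - \<epsilon>"
        using int * by (simp add: excess_def[abs_def] P.integral_on_spt)
      moreover have "slack g f y x = slack f g x y" for x by (rule slack_commute)
      ultimately show ?thesis by (simp only: gd_step_def step_eq)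
    qed
  qed
  finally show ?thesis by (simp add: energy_def)
qed

lemma energy_decreasing: "energy (F (Suc n)) (G (Suc n)) \<le> energy (F n) (G n)"
  and excess_le_energy_drop: "2 * (\<eta> / \<epsilon>) * (1 - \<eta> / \<epsilon>) * (LINT z|PQ. (excess (F n) (G n) (fst z) (snd z))\<^sup>2)
    \<le> energy (F n) (G n) - energy (F (Suc n)) (G (Suc n))"
proof -
  show "2 * (\<eta> / \<epsilon>) * (1 - \<eta> / \<epsilon>) * (LINT z|PQ. (excess (F n) (G n) (fst z) (snd z))\<^sup>2)
    \<le> energy (F n) (G n) - energy (F (Suc n)) (G (Suc n))"
    using energy_step[OF continuous_F[of n] continuous_G[of n]] by (simp add: F_Suc G_Suc)
  moreover have "0 \<le> 2 * (\<eta> / \<epsilon>) * (1 - \<eta> / \<epsilon>) * (LINT z|PQ. (excess (F n) (G n) (fst z) (snd z))\<^sup>2)"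
    using eta eps by simp
  ultimately show "energy (F (Suc n)) (G (Suc n)) \<le> energy (F n) (G n)" by linarith
qed

lemma energy_le: "energy (F n) (G n) \<le> energy f0 g0"
proof (induction n)
  case 0 show ?case by (simp add: F_def G_def)
next
  case (Suc n) then show ?case using energy_decreasing[of n] by linarith
qed

text \<open>
  The decreasing energies converge, so their decrements tend to zero.
\<close>
lemma excess_tendsto_0: "(\<lambda>n. LINT z|PQ. (excess (F n) (G n) (fst z) (snd z))\<^sup>2) \<longlonglongrightarrow> 0"
proof -
  let ?E = "\<lambda>n. energy (F n) (G n)"
  have "decseq ?E" using energy_decreasing by (intro decseq_SucI)
  moreover have "0 \<le> ?E n" for n by (simp add: energy_def)
  ultimately obtain L where L: "?E \<longlonglongrightarrow> L" using decseq_convergent[of ?E 0] by blast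
  define c where "c = 2 * (\<eta> / \<epsilon>) * (1 - \<eta> / \<epsilon>)"
  have c: "0 < c" using eta eps by (simp add: c_def)
  have "(\<lambda>n. (?E n - ?E (Suc n)) / c) \<longlonglongrightarrow> (L - L) / c"
    by (intro tendsto_intros L LIMSEQ_Suc) (use c in auto)
  then have lim: "(\<lambda>n. (?E n - ?E (Suc n)) / c) \<longlonglongrightarrow> 0" by simp
  show ?thesis
  proof (rule tendsto_sandwich[OF _ _ tendsto_const lim])
    show "\<forall>\<^sub>F n in sequentially. 0 \<le> (LINT z|PQ. (excess (F n) (G n) (fst z) (snd z))\<^sup>2)" by simp
    show "\<forall>\<^sub>F n in sequentially. (LINT z|PQ. (excess (F n) (G n) (fst z) (snd z))\<^sup>2) \<le> (?E n - ?E (Suc n)) / c"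
    proof (rule always_eventually, rule allI)
      fix n
      show "(LINT z|PQ. (excess (F n) (G n) (fst z) (snd z))\<^sup>2) \<le> (?E n - ?E (Suc n)) / c"
        using excess_le_energy_drop[of n, folded c_def] c by (simp add: pos_le_divide_eq mult.commute)
    qed
  qed
qed

end

context compactly_supported_prob
begin

text \<open>
  A function that is close to \<open>h\<close> in \<open>L\<^sup>2\<close> is close to \<open>h\<close> at some point of the support, and the
  Lipschitz condition carries the bound from there to the whole support.
\<close>
lemma lipschitz_L2_bounded:
  fixes h :: "'a \<Rightarrow> real"
  assumes h: "continuous_on (spt M) h"
  obtains B where "\<And>f x. K-lipschitz_on (spt M) f \<Longrightarrow> (LINT x|on_spt. (f x - h x)\<^sup>2) \<le> E \<Longrightarrow>
    x \<in> spt M \<Longrightarrow> \<bar>f x\<bar> \<le> B"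
proof -
  interpret M': prob_space on_spt by (rule prob_space_on_spt)
  obtain Bh where Bh: "\<And>x. x \<in> spt M \<Longrightarrow> \<bar>h x\<bar> \<le> Bh"
    using continuous_on_spt_bounded[OF h] by blast
  have "bounded (spt M)" using compact_spt by (rule compact_imp_bounded)
  then have diam: "dist x y \<le> diameter (spt M)" if "x \<in> spt M" "y \<in> spt M" for x y
    using that by (rule diameter_bounded_bound)
  have "\<bar>f x\<bar> \<le> Bh + sqrt (E + 1) + K * diameter (spt M)"
    if f: "K-lipschitz_on (spt M) f" and E: "(LINT x|on_spt. (f x - h x)\<^sup>2) \<le> E" and x: "x \<in> spt M" for f x
  proof -
    \<comment> \<open>the margin \<open>1\<close> turns a comparison of integrals into a strict one\<close>
    have "\<exists>z\<in>spt M. (f z - h z)\<^sup>2 \<le> E + 1"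
    proof (rule ccontr)
      assume "\<not> ?thesis"
      then have "E + 1 \<le> (f z - h z)\<^sup>2" if "z \<in> space on_spt" for z using that by force
      moreover have "integrable on_spt (\<lambda>z. (f z - h z)\<^sup>2)"
        by (intro integrable_on_spt continuous_intros lipschitz_on_continuous_on[OF f] h)
      ultimately have "(LINT z|on_spt. E + 1) \<le> (LINT z|on_spt. (f z - h z)\<^sup>2)"
        by (intro integral_mono) auto
      with E show False using M'.prob_space by simp
    qed
    then obtain z where z: "z \<in> spt M" "(f z - h z)\<^sup>2 \<le> E + 1" by blast
    have "\<bar>f z - h z\<bar> \<le> sqrt (E + 1)" using z(2) real_le_rsqrt by (simp add: real_le_rsqrt)
    moreover have "\<bar>f x - f z\<bar> \<le> K * diameter (spt M)"
      using lipschitz_onD[OF f x z(1)] mult_left_mono[OF diam[OF x z(1)] lipschitz_on_nonneg[OF f]]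
      by (simp add: dist_real_def)
    ultimately show ?thesis using Bh[OF z(1)] by linarith
  qed
  then show ?thesis using that by blast
qed

lemma lipschitz_subsequence:
  fixes X :: "nat \<Rightarrow> 'a \<Rightarrow> real"
  assumes lip: "\<And>n. K-lipschitz_on (spt M) (X n)" and B: "\<And>n x. x \<in> spt M \<Longrightarrow> \<bar>X n x\<bar> \<le> B"
  obtains l k where "continuous_on (spt M) l" "strict_mono (k :: nat \<Rightarrow> nat)"
    "uniform_limit (spt M) (\<lambda>n. X (k n)) l sequentially"
proof -
  have K: "0 \<le> K" using lip by (rule lipschitz_on_nonneg)
  have "\<exists>d>0. \<forall>n y. y \<in> spt M \<and> norm (x - y) < d \<longrightarrow> norm (X n x - X n y) < e"
    if x: "x \<in> spt M" and "0 < e" for x e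
  proof (intro exI[of _ "e / (K + 1)"] conjI allI impI)
    show "0 < e / (K + 1)" using K \<open>0 < e\<close> by simp
    fix n y assume y: "y \<in> spt M \<and> norm (x - y) < e / (K + 1)"
    have "norm (X n x - X n y) \<le> K * norm (x - y)"
      using lipschitz_onD[OF lip x, of y n] y by (simp add: dist_norm)
    also have "\<dots> \<le> (K + 1) * norm (x - y)" by (simp add: mult_right_mono)
    also have "\<dots> < e" using y K by (simp add: pos_less_divide_eq mult.commute)
    finally show "norm (X n x - X n y) < e" .
  qed
  then obtain l k where "continuous_on (spt M) l" "strict_mono (k :: nat \<Rightarrow> nat)"
    "\<And>e. 0 < e \<Longrightarrow> \<exists>N. \<forall>n x. n \<ge> N \<and> x \<in> spt M \<longrightarrow> norm (X (k n) x - l x) < e"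
    using Arzela_Ascoli[OF compact_spt, of X B] B by (metis real_norm_def)
  then show ?thesis
    by (intro that[of l k])
       (auto simp: uniform_limit_iff eventually_sequentially dist_norm, meson)
qed

end

context qot
begin

lemma near_zero_sets:
  assumes "continuous_on (spt Q) g"
  shows "{y \<in> spt Q. \<bar>slack f g x y\<bar> \<le> \<delta>} \<in> sets Q"
proof -
  have "closed {y \<in> spt Q. \<bar>slack f g x y\<bar> \<le> \<delta>}"
    using Q.closed_spt assms
    by (intro continuous_on_closed_Collect_le continuous_intros continuous_on_slack_right)
  then show ?thesis by (simp add: Q.sets_borel)
qed

end

context qot_descent
begin

lemma excess_continuous_left: "continuous_on (spt P) f \<Longrightarrow> continuous_on (spt P) (\<lambda>x. excess f g x y)"
  unfolding excess_def by (intro continuous_intros continuous_on_slack_left continuous_fs)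

lemma excess_continuous_right: "continuous_on (spt Q) g \<Longrightarrow> continuous_on (spt Q) (excess f g x)"
  unfolding excess_def[abs_def] by (intro continuous_intros continuous_on_slack_right continuous_gs)

lemma excess_square_integrable:
  assumes f: "continuous_on (spt P) f" and g: "continuous_on (spt Q) g"
  shows "integrable PQ (\<lambda>z. (excess f g (fst z) (snd z))\<^sup>2)"
proof -
  interpret P': prob_space P.on_spt by (rule P.prob_space_on_spt)
  interpret Q': prob_space Q.on_spt by (rule Q.prob_space_on_spt)
  interpret PQ: pair_prob_space P.on_spt Q.on_spt ..
  note [measurable] = excess_measurable[OF f g]
  obtain B where "\<And>x y. x \<in> spt P \<Longrightarrow> y \<in> spt Q \<Longrightarrow> \<bar>excess f g x y\<bar> \<le> B"
    using excess_bounded[OF f g] by blast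
  then show ?thesis
    by (intro PQ.integrable_bounded[of _ "B\<^sup>2"])
       (auto simp: space_pair_measure abs_le_square_iff[symmetric] intro!: order_trans[OF _ abs_ge_self])
qed

lemma excess_zero_everywhere:
  assumes f: "continuous_on (spt P) f" and g: "continuous_on (spt Q) g"
    and zero: "(LINT z|PQ. (excess f g (fst z) (snd z))\<^sup>2) = 0"
    and x: "x \<in> spt P" and y: "y \<in> spt Q"
  shows "excess f g x y = 0"
proof -
  interpret P': prob_space P.on_spt by (rule P.prob_space_on_spt)
  interpret Q': prob_space Q.on_spt by (rule Q.prob_space_on_spt)
  interpret PQ: pair_prob_space P.on_spt Q.on_spt ..
  note [measurable] = excess_measurable[OF f g]
  have "AE z in PQ. (excess f g (fst z) (snd z))\<^sup>2 = 0"
    using zero excess_square_integrable[OF f g] by (subst (asm) integral_nonneg_eq_0_iff_AE) auto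
  then have "AE z in PQ. excess f g (fst z) (snd z) = 0" by simp
  then have "AE x in P.on_spt. AE y in Q.on_spt. excess f g x y = 0"
    using PQ.AE_pair by fastforce
  then have "AE x in P.on_spt. excess f g x y = 0"
    by eventually_elim (use Q.continuous_AE_zero[OF excess_continuous_right[OF g]] y in blast)
  then show ?thesis
    using P.continuous_AE_zero[OF excess_continuous_left[OF f]] x by blast
qed

text \<open>
  Along a uniformly convergent subsequence the excess converges uniformly, while its \<open>L\<^sup>2\<close> norm tends
  to zero; so the limiting pair has zero excess, first almost everywhere and then, by continuity, on
  the product of the supports.
\<close>
lemma subsequence_limit:
  assumes r: "strict_mono (r :: nat \<Rightarrow> nat)"
  obtains k f g where "strict_mono (k :: nat \<Rightarrow> nat)"
    "uniform_limit (spt P) (\<lambda>n. F (r (k n))) f sequentially"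
    "uniform_limit (spt Q) (\<lambda>n. G (r (k n))) g sequentially"
    "solves_dual P Q \<epsilon> f g"
    "\<And>x y. x \<in> spt P \<Longrightarrow> y \<in> spt Q \<Longrightarrow> max (slack f g x y) 0 = max (slack fs gs x y) 0"
proof -
  interpret P': prob_space P.on_spt by (rule P.prob_space_on_spt)
  interpret Q': prob_space Q.on_spt by (rule Q.prob_space_on_spt)
  interpret PQ: pair_prob_space P.on_spt Q.on_spt ..
  have L2_le: "(LINT x|P.on_spt. (F n x - fs x)\<^sup>2) \<le> energy f0 g0"
    "(LINT y|Q.on_spt. (G n y - gs y)\<^sup>2) \<le> energy f0 g0" for n
    by (rule order_trans[OF _ energy_le[of n]], simp add: energy_def)+
  obtain BF where BF: "\<And>f x. K-lipschitz_on (spt P) f \<Longrightarrow>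
      (LINT x|P.on_spt. (f x - fs x)\<^sup>2) \<le> energy f0 g0 \<Longrightarrow> x \<in> spt P \<Longrightarrow> \<bar>f x\<bar> \<le> BF"
    using P.lipschitz_L2_bounded[OF continuous_fs, of K "energy f0 g0"] by metis
  obtain BG where BG: "\<And>g y. K-lipschitz_on (spt Q) g \<Longrightarrow>
      (LINT y|Q.on_spt. (g y - gs y)\<^sup>2) \<le> energy f0 g0 \<Longrightarrow> y \<in> spt Q \<Longrightarrow> \<bar>g y\<bar> \<le> BG"
    using Q.lipschitz_L2_bounded[OF continuous_gs, of K "energy f0 g0"] by metis
  have F_bd: "\<bar>F n x\<bar> \<le> BF" if "x \<in> spt P" for n x
    using BF[of "F n" x] iterates_lipschitz[of n] L2_le[of n] that by blast
  have G_bd: "\<bar>G n y\<bar> \<le> BG" if "y \<in> spt Q" for n y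
    using BG[of "G n" y] iterates_lipschitz[of n] L2_le[of n] that by blast
  obtain f k1 where f: "continuous_on (spt P) f" and k1: "strict_mono (k1 :: nat \<Rightarrow> nat)"
    and lim1: "uniform_limit (spt P) (\<lambda>n. F (r (k1 n))) f sequentially"
    using P.lipschitz_subsequence[of K "\<lambda>n. F (r n)" BF] iterates_lipschitz F_bd by blast
  obtain g k2 where g: "continuous_on (spt Q) g" and k2: "strict_mono (k2 :: nat \<Rightarrow> nat)"
    and lim2: "uniform_limit (spt Q) (\<lambda>n. G (r (k1 (k2 n)))) g sequentially"
    using Q.lipschitz_subsequence[of K "\<lambda>n. G (r (k1 n))" BG] iterates_lipschitz G_bd by blast
  define k where "k = k1 \<circ> k2"
  define m where "m n = r (k n)" for n
  have k: "strict_mono k" using k1 k2 by (simp add: k_def strict_mono_o)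
  then have m: "strict_mono m" using strict_mono_o[OF r k] by (simp add: m_def[abs_def] comp_def)
  have limF: "uniform_limit (spt P) (\<lambda>n. F (m n)) f sequentially"
    using filterlim_compose[OF lim1 filterlim_subseq[OF k2]] by (simp add: m_def k_def)
  have limG: "uniform_limit (spt Q) (\<lambda>n. G (m n)) g sequentially"
    using lim2 by (simp add: m_def k_def)
  have "(LINT z|PQ. (excess f g (fst z) (snd z))\<^sup>2) \<le> 0"
  proof (rule field_le_epsilon)
    fix e :: real assume e: "0 < e"
    \<comment> \<open>\<open>d \<le> 1\<close> gives \<open>8 d\<^sup>2 \<le> 8 d \<le> e / 2\<close>\<close>
    define d where "d = min 1 (e / 16)"
    have d: "0 < d" "8 * d\<^sup>2 \<le> e / 2"
    proof -
      show "0 < d" using e by (simp add: d_def)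
      have "d * d \<le> 1 * d" using \<open>0 < d\<close> by (intro mult_right_mono) (auto simp: d_def)
      moreover have "8 * d \<le> e / 2" by (simp add: d_def)
      ultimately show "8 * d\<^sup>2 \<le> e / 2" by (simp add: power2_eq_square)
    qed
    have "(\<lambda>n. LINT z|PQ. (excess (F (m n)) (G (m n)) (fst z) (snd z))\<^sup>2) \<longlonglongrightarrow> 0"
      using LIMSEQ_subseq_LIMSEQ[OF excess_tendsto_0 m] by (simp add: comp_def)
    then have "\<forall>\<^sub>F n in sequentially. (LINT z|PQ. (excess (F (m n)) (G (m n)) (fst z) (snd z))\<^sup>2) < e / 4"
      using e by (intro order_tendstoD) auto
    then have "\<forall>\<^sub>F n in sequentially. (LINT z|PQ. (excess (F (m n)) (G (m n)) (fst z) (snd z))\<^sup>2) < e / 4 \<and>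
        (\<forall>x\<in>spt P. dist (F (m n) x) (f x) < d) \<and> (\<forall>y\<in>spt Q. dist (G (m n) y) (g y) < d)"
      using uniform_limitD[OF limF d(1)] uniform_limitD[OF limG d(1)] by (simp add: eventually_conj_iff)
    then obtain n where n: "(LINT z|PQ. (excess (F (m n)) (G (m n)) (fst z) (snd z))\<^sup>2) < e / 4"
      "\<And>x. x \<in> spt P \<Longrightarrow> \<bar>F (m n) x - f x\<bar> < d" "\<And>y. y \<in> spt Q \<Longrightarrow> \<bar>G (m n) y - g y\<bar> < d"
      using eventually_happens'[OF sequentially_bot] unfolding dist_real_def by blast
    have "(LINT z|PQ. (excess f g (fst z) (snd z))\<^sup>2)
        \<le> (LINT z|PQ. 2 * (excess (F (m n)) (G (m n)) (fst z) (snd z))\<^sup>2 + 8 * d\<^sup>2)"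
    proof (rule integral_mono)
      fix z assume z: "z \<in> space PQ"
      let ?a = "excess f g (fst z) (snd z)" and ?b = "excess (F (m n)) (G (m n)) (fst z) (snd z)"
      have "\<bar>?a - ?b\<bar> \<le> 2 * d"
        using n(2)[of "fst z"] n(3)[of "snd z"] z
        by (auto simp: excess_def slack_def space_pair_measure)
      then have "(?a - ?b)\<^sup>2 \<le> (2 * d)\<^sup>2" using d abs_le_square_iff[of "?a - ?b" "2 * d"] by simp
      moreover have "?a\<^sup>2 \<le> 2 * ?b\<^sup>2 + 2 * (?a - ?b)\<^sup>2"
        using zero_le_power2[of "?a - 2 * ?b"] by (simp add: power2_eq_square algebra_simps)
      ultimately show "?a\<^sup>2 \<le> 2 * ?b\<^sup>2 + 8 * d\<^sup>2" by (simp add: power_mult_distrib)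
    qed (use excess_square_integrable[OF f g] excess_square_integrable[OF continuous_F continuous_G] in auto)
    also have "\<dots> = 2 * (LINT z|PQ. (excess (F (m n)) (G (m n)) (fst z) (snd z))\<^sup>2) + 8 * d\<^sup>2"
      using excess_square_integrable[OF continuous_F continuous_G] PQ.prob_space by simp
    also have "\<dots> \<le> 0 + e" using n(1) d(2) by simp
    finally show "(LINT z|PQ. (excess f g (fst z) (snd z))\<^sup>2) \<le> 0 + e" .
  qed
  then have "(LINT z|PQ. (excess f g (fst z) (snd z))\<^sup>2) = 0"
    by (intro antisym) auto
  then have eq: "max (slack f g x y) 0 = max (slack fs gs x y) 0" if "x \<in> spt P" "y \<in> spt Q" for x y
    using excess_zero_everywhere[OF f g] that by (auto simp: excess_def)
  have "solves_dual P Q \<epsilon> f g"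
    unfolding solves_dual_def P.integral_on_spt Q.integral_on_spt
  proof (intro conjI ballI f g)
    fix y assume y: "y \<in> spt Q"
    have "(LINT x|P.on_spt. max (slack f g x y) 0) = (LINT x|P.on_spt. max (slack fs gs x y) 0)"
      using eq y by (intro Bochner_Integration.integral_cong) auto
    then show "\<epsilon> = (LINT x|P.on_spt. max (slack f g x y) 0)"
      using sol y by (simp add: solves_dual_def P.integral_on_spt)
  next
    fix x assume x: "x \<in> spt P"
    have "(LINT y|Q.on_spt. max (slack f g x y) 0) = (LINT y|Q.on_spt. max (slack fs gs x y) 0)"
      using eq x by (intro Bochner_Integration.integral_cong) auto
    then show "\<epsilon> = (LINT y|Q.on_spt. max (slack f g x y) 0)"
      using sol x by (simp add: solves_dual_def Q.integral_on_spt)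
  qed
  then show ?thesis
    using that[OF k, of f g] limF limG eq by (simp add: m_def)
qed

section \<open>Sign mismatches\<close>

definition mismatch where
  "mismatch n x = {y \<in> spt Q. (0 \<le> slack fs gs x y) \<noteq> (0 \<le> slack (F n) (G n) x y)}"

text \<open>
  If the claim failed along a subsequence, a further subsequence would converge to an optimal pair
  \<open>(f, g)\<close> whose slack has the same positive part as that of \<open>(fs, gs)\<close>.  A sign mismatch far along
  this subsequence forces one of the two slacks to be close to zero, and the points where this
  happens have uniformly small mass.
\<close>
lemma mismatch_small:
  assumes frontier: "\<And>C. convex C \<Longrightarrow> measure Q (frontier C) = 0" and e: "0 < e"
  shows "\<forall>\<^sub>F n in sequentially. \<forall>x\<in>spt P. measure Q (mismatch n x) < e"
proof (rule ccontr)
  assume "\<not> ?thesis"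
  then obtain r where r: "strict_mono (r :: nat \<Rightarrow> nat)"
    and bad: "\<And>n. \<not> (\<forall>x\<in>spt P. measure Q (mismatch (r n) x) < e)"
    using not_eventually_sequentiallyD by blast
  obtain k f g where k: "strict_mono (k :: nat \<Rightarrow> nat)"
    and limF: "uniform_limit (spt P) (\<lambda>n. F (r (k n))) f sequentially"
    and limG: "uniform_limit (spt Q) (\<lambda>n. G (r (k n))) g sequentially"
    and lim_sol: "solves_dual P Q \<epsilon> f g"
    and eq: "\<And>x y. x \<in> spt P \<Longrightarrow> y \<in> spt Q \<Longrightarrow> max (slack f g x y) 0 = max (slack fs gs x y) 0"
    using subsequence_limit[OF r] by metis
  have small: "\<exists>\<delta>>0. \<forall>x\<in>spt P. measure Q {y \<in> spt Q. \<bar>slack f g x y\<bar> \<le> \<delta>} < e / 2"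
    if "solves_dual P Q \<epsilon> f g" for f g
    using that e zero_slack_null[OF that _ frontier]
    by (intro small_near_zero_set Q.finite_measure_axioms Q.sets_borel P.compact_spt Q.compact_spt
        continuous_on_slack) (auto simp: solves_dual_def)
  obtain \<delta>1 where \<delta>1: "\<delta>1 > 0" "\<And>x. x \<in> spt P \<Longrightarrow> measure Q {y \<in> spt Q. \<bar>slack f g x y\<bar> \<le> \<delta>1} < e / 2"
    using small[OF lim_sol] by blast
  obtain \<delta>2 where \<delta>2: "\<delta>2 > 0" "\<And>x. x \<in> spt P \<Longrightarrow> measure Q {y \<in> spt Q. \<bar>slack fs gs x y\<bar> \<le> \<delta>2} < e / 2"
    using small[OF sol] by blast
  have g: "continuous_on (spt Q) g" using lim_sol by (simp add: solves_dual_def)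
  have "\<forall>\<^sub>F n in sequentially. (\<forall>x\<in>spt P. dist (F (r (k n)) x) (f x) < \<delta>1 / 2) \<and>
      (\<forall>y\<in>spt Q. dist (G (r (k n)) y) (g y) < \<delta>1 / 2)"
    using uniform_limitD[OF limF, of "\<delta>1 / 2"] uniform_limitD[OF limG, of "\<delta>1 / 2"] \<delta>1(1)
    by (simp add: eventually_conj_iff)
  then obtain n where n: "\<And>x. x \<in> spt P \<Longrightarrow> \<bar>F (r (k n)) x - f x\<bar> < \<delta>1 / 2"
      "\<And>y. y \<in> spt Q \<Longrightarrow> \<bar>G (r (k n)) y - g y\<bar> < \<delta>1 / 2"
    using eventually_happens'[OF sequentially_bot] unfolding dist_real_def by blast
  have "measure Q (mismatch (r (k n)) x) < e" if x: "x \<in> spt P" for x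
  proof -
    let ?D1 = "{y \<in> spt Q. \<bar>slack f g x y\<bar> \<le> \<delta>1}" and ?D2 = "{y \<in> spt Q. \<bar>slack fs gs x y\<bar> \<le> \<delta>2}"
    have "mismatch (r (k n)) x \<subseteq> ?D1 \<union> ?D2"
    proof
      fix y assume y: "y \<in> mismatch (r (k n)) x"
      then have yQ: "y \<in> spt Q" by (simp add: mismatch_def)
      have "\<bar>slack (F (r (k n))) (G (r (k n))) x y - slack f g x y\<bar> < \<delta>1"
        using n(1)[OF x] n(2)[OF yQ] unfolding slack_def by linarith
      with y eq[OF x yQ] \<delta>1(1) \<delta>2(1) show "y \<in> ?D1 \<union> ?D2"
        by (auto simp: mismatch_def max_def split: if_splits)
    qed
    then have "measure Q (mismatch (r (k n)) x) \<le> measure Q (?D1 \<union> ?D2)"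
      using near_zero_sets[OF g] near_zero_sets[OF continuous_gs] by (intro Q.finite_measure_mono) auto
    also have "\<dots> \<le> measure Q ?D1 + measure Q ?D2"
      using near_zero_sets[OF g] near_zero_sets[OF continuous_gs] by (intro measure_Un_le)
    also have "\<dots> < e" using \<delta>1(2)[OF x] \<delta>2(2)[OF x] by simp
    finally show ?thesis .
  qed
  with bad[of "k n"] show False by blast
qed

end

section \<open>The components of the operators\<close>

text \<open>
  The first component of the averaged operator before projection.  The second component is the same
  expression with the two marginals exchanged, and at \<open>(fn, gn) = (fs, gs)\<close> the expression is the
  corresponding component of the limit operator.
\<close>
definition Ln_component where
  "Ln_component P Q c fs gs fn gn f g x =
    (if x \<in> spt P
     then f x * (1 - c * measure (lborel \<Otimes>\<^sub>M Q) (Sn_set Q fs gs fn gn x))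
          - c * (LINT z:Sn_set Q fs gs fn gn x|(lborel \<Otimes>\<^sub>M Q). g (snd z))
     else 0)"

lemma Tn_set_eq_Sn_set: "Tn_set P fs gs fn gn y = Sn_set P gs fs gn fn y"
  by (simp add: Tn_set_def Sn_set_def norm_minus_commute add.commute)

lemma Sn_set_slack:
  "Sn_set Q fs gs fn gn x =
    {(l, y). l \<in> {0..1} \<and> y \<in> spt Q \<and> 0 \<le> l * slack fs gs x y + (1 - l) * slack fn gn x y}"
proof -
  have "l * (a - N) + (1 - l) * (b - N) = l * a + (1 - l) * b - N" for l a b N :: real
    by (simp add: algebra_simps)
  then show ?thesis by (simp add: Sn_set_def slack_def)
qed

lemma convex_comb_same: "l * s + (1 - l) * s = (s :: real)"
  by (simp add: algebra_simps)

lemma Sn_set_same: "Sn_set Q fs gs fs gs x = {0..1} \<times> S_set Q fs gs x"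
  by (auto simp: Sn_set_def S_set_def convex_comb_same)

lemma T_set_eq_S_set: "T_set P fs gs y = S_set P gs fs y"
  by (simp add: T_set_def S_set_def norm_minus_commute add.commute)

lemma Ln_op_eq_proj_components:
  "Ln_op P Q \<epsilon> \<eta> fs gs v u = proj_oplus P Q
     (Ln_component P Q (\<eta> / \<epsilon>) fs gs (fst v) (snd v) (fst u) (snd u),
      Ln_component Q P (\<eta> / \<epsilon>) gs fs (snd v) (fst v) (snd u) (fst u))"
  unfolding Ln_op_def Ln_component_def[abs_def] Tn_set_eq_Sn_set case_prod_beta by (rule refl)

lemma convex_comb_sign_mismatch:
  fixes s t l :: real
  assumes l: "0 \<le> l" "l \<le> 1" and ne: "(0 \<le> l * s + (1 - l) * t) \<noteq> (0 \<le> s)"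
  shows "(0 \<le> s) \<noteq> (0 \<le> t)"
proof
  assume same: "(0 \<le> s) = (0 \<le> t)"
  show False
  proof (cases "0 \<le> s")
    case True
    then show False using same l ne by simp
  next
    case False
    define m where "m = max s t"
    have "m < 0" using False same by (simp add: m_def)
    have "l * s + (1 - l) * t \<le> l * m + (1 - l) * m"
      using l by (intro add_mono mult_left_mono) (auto simp: m_def)
    also have "\<dots> = m" by (simp add: algebra_simps)
    finally show False using False ne \<open>m < 0\<close> by linarith
  qed
qed

section \<open>Integrals over the strip \<open>[0, 1] \<times> X\<close>\<close>

context prob_space
begin

lemma unit_strip_integral:
  fixes h :: "'a \<Rightarrow> real"
  assumes h: "integrable M h"
  shows "integrable (lborel \<Otimes>\<^sub>M M) (\<lambda>z. indicator {0..1::real} (fst z) * h (snd z))"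
    and "(LINT z|(lborel \<Otimes>\<^sub>M M). indicator {0..1::real} (fst z) * h (snd z)) = (LINT y|M. h y)"
proof -
  interpret LM: pair_sigma_finite lborel M ..
  have [measurable]: "h \<in> borel_measurable M" using h by auto
  have ind: "integrable lborel (indicator {0..1::real} :: real \<Rightarrow> real)" by simp
  show *: "integrable (lborel \<Otimes>\<^sub>M M) (\<lambda>z. indicator {0..1::real} (fst z) * h (snd z))"
  proof (rule LM.Fubini_integrable)
    show "integrable lborel (\<lambda>l. LINT y|M. norm (indicator {0..1::real} (fst (l, y)) * h (snd (l, y))))"
      using ind h by (simp add: abs_mult)
  qed (use h in auto)
  show "(LINT z|(lborel \<Otimes>\<^sub>M M). indicator {0..1::real} (fst z) * h (snd z)) = (LINT y|M. h y)"
    using LM.integral_fst'[OF *] by simp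
qed

lemma strip_over_set:
  fixes h :: "'a \<Rightarrow> real"
  assumes h: "integrable M h" and S[measurable]: "S \<in> sets M"
  shows "measure (lborel \<Otimes>\<^sub>M M) ({0..1::real} \<times> S) = measure M S"
    and "(LINT z:{0..1::real} \<times> S|(lborel \<Otimes>\<^sub>M M). h (snd z)) = (LINT y:S|M. h y)"
proof -
  have "emeasure (lborel \<Otimes>\<^sub>M M) ({0..1::real} \<times> S) = emeasure M S"
    by (subst emeasure_pair_measure_Times) auto
  then show "measure (lborel \<Otimes>\<^sub>M M) ({0..1::real} \<times> S) = measure M S"
    by (simp add: measure_def)
  have "integrable M (\<lambda>y. indicator S y * h y)"
    using h by (intro integrable_mult_indicator[where 'b = real, simplified]) auto
  from unit_strip_integral(2)[OF this]
  show "(LINT z:{0..1::real} \<times> S|(lborel \<Otimes>\<^sub>M M). h (snd z)) = (LINT y:S|M. h y)"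
    by (simp add: set_lebesgue_integral_def indicator_times mult.assoc)
qed

lemma strip_set_integrable:
  fixes h :: "'a \<Rightarrow> real" and E :: "(real \<times> 'a) set"
  assumes h: "integrable M h" and E: "E \<in> sets (lborel \<Otimes>\<^sub>M M)" "E \<subseteq> {0..1} \<times> UNIV"
  shows "integrable (lborel \<Otimes>\<^sub>M M) (\<lambda>z. indicator E z * h (snd z))"
proof (rule Bochner_Integration.integrable_bound)
  show "integrable (lborel \<Otimes>\<^sub>M M) (\<lambda>z. indicator {0..1::real} (fst z) * h (snd z))"
    by (rule unit_strip_integral[OF h])
  have [measurable]: "h \<in> borel_measurable M" using h by auto
  note [measurable] = E(1)
  show "(\<lambda>z. indicator E z * h (snd z)) \<in> borel_measurable (lborel \<Otimes>\<^sub>M M)" by measurable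
  show "AE z in lborel \<Otimes>\<^sub>M M. norm (indicator E z * h (snd z)) \<le> norm (indicator {0..1::real} (fst z) * h (snd z))"
    using E(2) by (intro AE_I2) (auto simp: indicator_def)
qed

lemma L2_space_integrable:
  assumes "h \<in> L2_space M"
  shows "integrable M h"
proof -
  have "h \<in> borel_measurable M" "integrable M (\<lambda>x. (h x)\<^sup>2)"
    using assms by (auto simp: L2_space_def)
  then have "integrable M (\<lambda>x. 1 * h x)"
    by (intro integral_Cauchy_Schwarz(1)) auto
  then show ?thesis by simp
qed

text \<open>
  Integrals over subsets of the strip that differ only above \<open>D\<close> differ by at most the integral of \<open>\<bar>h\<bar>\<close>
  over \<open>D\<close>, to which the Cauchy-Schwarz inequality applies.
\<close>
lemma strip_integral_diff_square_le:
  fixes h :: "'a \<Rightarrow> real" and E E' :: "(real \<times> 'a) set"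
  assumes h: "h \<in> L2_space M"
    and E: "E \<in> sets (lborel \<Otimes>\<^sub>M M)" "E \<subseteq> {0..1} \<times> UNIV"
    and E': "E' \<in> sets (lborel \<Otimes>\<^sub>M M)" "E' \<subseteq> {0..1} \<times> UNIV"
    and D[measurable]: "D \<in> sets M"
    and diff: "\<And>l y. (l, y) \<in> (E - E') \<union> (E' - E) \<Longrightarrow> y \<in> D"
  shows "((LINT z:E|(lborel \<Otimes>\<^sub>M M). h (snd z)) - (LINT z:E'|(lborel \<Otimes>\<^sub>M M). h (snd z)))\<^sup>2
    \<le> measure M D * (LINT y|M. (h y)\<^sup>2)"
proof -
  let ?\<mu> = "lborel \<Otimes>\<^sub>M M"
  have [measurable]: "h \<in> borel_measurable M" and sq: "integrable M (\<lambda>y. (h y)\<^sup>2)"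
    using h by (auto simp: L2_space_def)
  note ih = L2_space_integrable[OF h]
  have ind_sq: "(\<lambda>y. (indicator D y)\<^sup>2) = (indicator D :: 'a \<Rightarrow> real)"
    by (auto simp: indicator_def)
  have iDh: "integrable M (\<lambda>y. indicator D y * \<bar>h y\<bar>)"
    using ih by (intro integrable_mult_indicator[where 'b = real, simplified]) auto
  have "(LINT z:E|?\<mu>. h (snd z)) - (LINT z:E'|?\<mu>. h (snd z))
      = (LINT z|?\<mu>. indicator E z * h (snd z) - indicator E' z * h (snd z))"
    using strip_set_integrable[OF ih E] strip_set_integrable[OF ih E']
    by (simp add: set_lebesgue_integral_def)
  then have "\<bar>(LINT z:E|?\<mu>. h (snd z)) - (LINT z:E'|?\<mu>. h (snd z))\<bar>
      \<le> (LINT z|?\<mu>. \<bar>indicator E z * h (snd z) - indicator E' z * h (snd z)\<bar>)"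
    by (simp only: integral_abs_bound)
  also have "\<dots> \<le> (LINT z|?\<mu>. indicator {0..1::real} (fst z) * (indicator D (snd z) * \<bar>h (snd z)\<bar>))"
  proof (rule integral_mono)
    fix z :: "real \<times> 'a"
    show "\<bar>indicator E z * h (snd z) - indicator E' z * h (snd z)\<bar>
        \<le> indicator {0..1::real} (fst z) * (indicator D (snd z) * \<bar>h (snd z)\<bar>)"
      using E(2) E'(2) diff[of "fst z" "snd z"] by (cases z) (auto simp: indicator_def)
  qed (use strip_set_integrable[OF ih E] strip_set_integrable[OF ih E'] unit_strip_integral(1)[OF iDh] in auto)
  also have "\<dots> = (LINT y|M. indicator D y * \<bar>h y\<bar>)" by (rule unit_strip_integral(2)[OF iDh])
  finally have "((LINT z:E|?\<mu>. h (snd z)) - (LINT z:E'|?\<mu>. h (snd z)))\<^sup>2 \<le> (LINT y|M. indicator D y * \<bar>h y\<bar>)\<^sup>2"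
    by (metis abs_ge_zero power2_abs power_mono)
  also have "\<dots> \<le> (LINT y|M. (indicator D y)\<^sup>2) * (LINT y|M. \<bar>h y\<bar>\<^sup>2)"
    by (rule integral_Cauchy_Schwarz(2)) (use sq ind_sq in \<open>simp_all add: emeasure_eq_measure\<close>)
  also have "(LINT y|M. (indicator D y)\<^sup>2) = measure M D"
    using ind_sq sets.sets_into_space[OF D] by (simp add: Int_absorb2)
  finally show ?thesis by simp
qed

lemma shifted_square_integral_le:
  assumes g: "g \<in> L2_space M"
  shows "(\<lambda>y. a + g y) \<in> L2_space M"
    and "(LINT y|M. (a + g y)\<^sup>2) \<le> 2 * a\<^sup>2 + 2 * (LINT y|M. (g y)\<^sup>2)"
proof -
  have [measurable]: "g \<in> borel_measurable M" and sq: "integrable M (\<lambda>y. (g y)\<^sup>2)"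
    using g by (auto simp: L2_space_def)
  have "(\<lambda>y. (a + g y)\<^sup>2) = (\<lambda>y. a\<^sup>2 + 2 * a * g y + (g y)\<^sup>2)"
    by (auto simp: power2_eq_square algebra_simps)
  then have int: "integrable M (\<lambda>y. (a + g y)\<^sup>2)"
    using sq L2_space_integrable[OF g] by simp
  then show "(\<lambda>y. a + g y) \<in> L2_space M" by (simp add: L2_space_def)
  have "(LINT y|M. (a + g y)\<^sup>2) \<le> (LINT y|M. 2 * a\<^sup>2 + 2 * (g y)\<^sup>2)"
  proof (rule integral_mono)
    fix y show "(a + g y)\<^sup>2 \<le> 2 * a\<^sup>2 + 2 * (g y)\<^sup>2"
      using zero_le_power2[of "a - g y"] by (simp add: power2_eq_square algebra_simps)
  qed (use int sq in auto)
  also have "\<dots> = 2 * a\<^sup>2 + 2 * (LINT y|M. (g y)\<^sup>2)" using sq prob_space by simp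
  finally show "(LINT y|M. (a + g y)\<^sup>2) \<le> 2 * a\<^sup>2 + 2 * (LINT y|M. (g y)\<^sup>2)" .
qed

end

section \<open>Stability of the components\<close>

context qot
begin

text \<open>
  Joint measurability in \<open>(x, \<lambda>, y)\<close>, which is what makes the components measurable in \<open>x\<close>; the graph is
  closed because the slacks are continuous on the product of the supports.
\<close>
lemma Sn_graph_sets:
  assumes cont: "continuous_on (spt P) fs" "continuous_on (spt P) fn"
    "continuous_on (spt Q) gs" "continuous_on (spt Q) gn"
  shows "{(x, z). x \<in> spt P \<and> z \<in> Sn_set Q fs gs fn gn x} \<in> sets (P \<Otimes>\<^sub>M (lborel \<Otimes>\<^sub>M Q))"
proof -
  let ?X = "spt P \<times> ({0..1::real} \<times> spt Q)"
  define \<psi> where "\<psi> = (\<lambda>(x, l, y). l * slack fs gs x y + (1 - l) * slack fn gn x y)"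
  have slack_cont: "continuous_on ?X (\<lambda>w. slack f g (fst w) (snd (snd w)))"
    if "continuous_on (spt P) f" "continuous_on (spt Q) g" for f g
  proof -
    have "continuous_on ?X (\<lambda>w. (fst w, snd (snd w)))" by (intro continuous_intros)
    moreover have "(\<lambda>w. (fst w, snd (snd w))) ` ?X \<subseteq> spt P \<times> spt Q" by auto
    ultimately show ?thesis using continuous_on_compose2[OF continuous_on_slack[OF that]] by fastforce
  qed
  have "continuous_on ?X \<psi>"
    unfolding \<psi>_def case_prod_beta using cont by (intro continuous_intros slack_cont)
  then have "closed {w \<in> ?X. 0 \<le> \<psi> w}"
    by (intro continuous_on_closed_Collect_le continuous_intros closed_Times P.closed_spt Q.closed_spt) auto
  moreover have "{w \<in> ?X. 0 \<le> \<psi> w} = {(x, z). x \<in> spt P \<and> z \<in> Sn_set Q fs gs fn gn x}"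
    by (auto simp: \<psi>_def Sn_set_slack)
  moreover have "sets (P \<Otimes>\<^sub>M (lborel \<Otimes>\<^sub>M Q)) = sets (borel :: ('a \<times> real \<times> 'a) measure)"
    by (simp add: borel_prod[symmetric] P.sets_borel Q.sets_borel cong: sets_pair_measure_cong)
  ultimately show ?thesis by simp
qed

lemma Sn_set_sets:
  assumes "continuous_on (spt P) fs" "continuous_on (spt P) fn"
    "continuous_on (spt Q) gs" "continuous_on (spt Q) gn" and x: "x \<in> spt P"
  shows "Sn_set Q fs gs fn gn x \<in> sets (lborel \<Otimes>\<^sub>M Q)"
  using sets_Pair1[OF Sn_graph_sets[OF assms(1-4)], of x] x by (simp add: vimage_def)

lemma Sn_set_subset: "Sn_set Q fs gs fn gn x \<subseteq> {0..1} \<times> UNIV"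
  by (auto simp: Sn_set_def)

lemma S_set_sets:
  assumes "continuous_on (spt Q) gs"
  shows "S_set Q fs gs x \<in> sets Q"
proof -
  have "S_set Q fs gs x = {y \<in> spt Q. 0 \<le> slack fs gs x y}"
    by (auto simp: S_set_def slack_def)
  moreover have "closed {y \<in> spt Q. 0 \<le> slack fs gs x y}"
    using assms Q.closed_spt
    by (intro continuous_on_closed_Collect_le continuous_intros continuous_on_slack_right)
  ultimately show ?thesis by (simp add: Q.sets_borel)
qed

lemma Ln_component_at_potentials:
  assumes "continuous_on (spt Q) gs" and g: "g \<in> L2_space Q"
  shows "Ln_component P Q c fs gs fs gs f g x =
    (if x \<in> spt P
     then f x * (1 - c * measure Q (S_set Q fs gs x)) - c * (LINT y:S_set Q fs gs x|Q. g y)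
     else 0)"
  using Q.strip_over_set[OF Q.L2_space_integrable[OF g] S_set_sets[OF assms(1)]]
  by (simp add: Ln_component_def Sn_set_same)

text \<open>
  Both terms with the factor \<open>c\<close> are merged into one integral, so that the multiplication part and the
  integral part of the operator are estimated at once.
\<close>
lemma Ln_component_as_perturbation:
  assumes cont: "continuous_on (spt P) fs" "continuous_on (spt P) fn"
    "continuous_on (spt Q) gs" "continuous_on (spt Q) gn"
    and g: "g \<in> L2_space Q" and x: "x \<in> spt P"
  shows "Ln_component P Q c fs gs fn gn f g x
    = f x - c * (LINT z:Sn_set Q fs gs fn gn x|(lborel \<Otimes>\<^sub>M Q). f x + g (snd z))"
proof -
  let ?\<mu> = "lborel \<Otimes>\<^sub>M Q" and ?E = "Sn_set Q fs gs fn gn x"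
  note E = Sn_set_sets[OF cont x] Sn_set_subset[of fs gs fn gn x]
  have "integrable ?\<mu> (\<lambda>z. indicator ?E z * f x)"
    using Q.strip_set_integrable[OF _ E, of "\<lambda>_. f x"] by simp
  moreover have "integrable ?\<mu> (\<lambda>z. indicator ?E z * g (snd z))"
    using Q.strip_set_integrable[OF Q.L2_space_integrable[OF g] E] .
  ultimately have "(LINT z|?\<mu>. indicator ?E z * f x + indicator ?E z * g (snd z))
      = (LINT z|?\<mu>. indicator ?E z * f x) + (LINT z|?\<mu>. indicator ?E z * g (snd z))"
    by (rule Bochner_Integration.integral_add)
  moreover have "(LINT z|?\<mu>. indicator ?E z * f x) = f x * measure ?\<mu> ?E"
    using sets.sets_into_space[OF E(1)] by (simp add: Int_absorb2)
  ultimately have "(LINT z:?E|?\<mu>. f x + g (snd z)) = f x * measure ?\<mu> ?E + (LINT z:?E|?\<mu>. g (snd z))"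
    by (simp add: set_lebesgue_integral_def distrib_left)
  then show ?thesis using x by (simp add: Ln_component_def algebra_simps)
qed

lemma Ln_component_diff_square_le:
  assumes cont: "continuous_on (spt P) fs" "continuous_on (spt P) fn"
    "continuous_on (spt Q) gs" "continuous_on (spt Q) gn"
    and g: "g \<in> L2_space Q" and x: "x \<in> spt P"
  shows "(Ln_component P Q c fs gs fn gn f g x - Ln_component P Q c fs gs fs gs f g x)\<^sup>2
    \<le> c\<^sup>2 * measure Q {y \<in> spt Q. (0 \<le> slack fs gs x y) \<noteq> (0 \<le> slack fn gn x y)}
        * (2 * (f x)\<^sup>2 + 2 * (LINT y|Q. (g y)\<^sup>2))"
proof -
  let ?\<mu> = "lborel \<Otimes>\<^sub>M Q" and ?E = "Sn_set Q fs gs fn gn x" and ?E' = "Sn_set Q fs gs fs gs x"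
  define D where "D = {y \<in> spt Q. (0 \<le> slack fs gs x y) \<noteq> (0 \<le> slack fn gn x y)}"
  have "D = (S_set Q fs gs x - S_set Q fn gn x) \<union> (S_set Q fn gn x - S_set Q fs gs x)"
    by (auto simp: D_def S_set_def slack_def)
  then have D: "D \<in> sets Q"
    using S_set_sets cont by (simp only:) (intro sets.Un sets.Diff)
  have "((LINT z:?E|?\<mu>. f x + g (snd z)) - (LINT z:?E'|?\<mu>. f x + g (snd z)))\<^sup>2
      \<le> measure Q D * (LINT y|Q. (f x + g y)\<^sup>2)"
  proof (rule Q.strip_integral_diff_square_le)
    fix l y assume "(l, y) \<in> (?E - ?E') \<union> (?E' - ?E)"
    then show "y \<in> D"
      using convex_comb_sign_mismatch[of l "slack fs gs x y" "slack fn gn x y"]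
      by (auto simp: Sn_set_slack D_def convex_comb_same)
  qed (use Sn_set_sets[OF cont x] Sn_set_sets[OF cont(1,1,3,3) x] Sn_set_subset D
      Q.shifted_square_integral_le(1)[OF g] in auto)
  also have "\<dots> \<le> measure Q D * (2 * (f x)\<^sup>2 + 2 * (LINT y|Q. (g y)\<^sup>2))"
    using Q.shifted_square_integral_le(2)[OF g, of "f x"] by (intro mult_left_mono) auto
  finally have "c\<^sup>2 * ((LINT z:?E|?\<mu>. f x + g (snd z)) - (LINT z:?E'|?\<mu>. f x + g (snd z)))\<^sup>2
      \<le> c\<^sup>2 * (measure Q D * (2 * (f x)\<^sup>2 + 2 * (LINT y|Q. (g y)\<^sup>2)))"
    by (intro mult_left_mono) auto
  moreover have "Ln_component P Q c fs gs fn gn f g x - Ln_component P Q c fs gs fs gs f g x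
      = - (c * ((LINT z:?E|?\<mu>. f x + g (snd z)) - (LINT z:?E'|?\<mu>. f x + g (snd z))))"
    unfolding Ln_component_as_perturbation[OF cont g x] Ln_component_as_perturbation[OF cont(1,1,3,3) g x] by (simp add: algebra_simps)
  ultimately show ?thesis by (simp add: D_def power_mult_distrib mult.assoc)
qed

text \<open>
  The bound is that of \<open>strip_integral_diff_square_le\<close> for the comparison with the empty set.
\<close>
lemma Ln_component_L2:
  assumes cont: "continuous_on (spt P) fs" "continuous_on (spt P) fn"
    "continuous_on (spt Q) gs" "continuous_on (spt Q) gn"
    and f: "f \<in> L2_space P" and g: "g \<in> L2_space Q"
  shows "Ln_component P Q c fs gs fn gn f g \<in> L2_space P"
proof -
  let ?\<mu> = "lborel \<Otimes>\<^sub>M Q" and ?E = "Sn_set Q fs gs fn gn"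
  define W where "W = {(x, z). x \<in> spt P \<and> z \<in> ?E x}"
  define A where "A x = (LINT z|?\<mu>. indicator W (x, z) * (f x + g (snd z)))" for x
  have [measurable]: "f \<in> borel_measurable P" "g \<in> borel_measurable Q"
    and sqf: "integrable P (\<lambda>x. (f x)\<^sup>2)"
    using f g by (auto simp: L2_space_def)
  have [measurable]: "W \<in> sets (P \<Otimes>\<^sub>M ?\<mu>)" unfolding W_def using cont by (rule Sn_graph_sets)
  interpret LQ: pair_sigma_finite lborel Q ..
  interpret \<mu>: sigma_finite_measure ?\<mu> by (rule LQ.sigma_finite_measure_axioms)
  have A_meas[measurable]: "A \<in> borel_measurable P" unfolding A_def by measurable
  have A: "A x = (LINT z:?E x|?\<mu>. f x + g (snd z))" if "x \<in> spt P" for x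
    unfolding A_def set_lebesgue_integral_def
    using that by (intro Bochner_Integration.integral_cong) (auto simp: W_def indicator_def)
  have half: "Ln_component P Q c fs gs fn gn f g x = indicator (spt P) x * (f x - c * A x)" for x
    using Ln_component_as_perturbation[OF cont g, of x c f] A[of x] by (simp add: Ln_component_def indicator_def)
  have meas[measurable]: "Ln_component P Q c fs gs fn gn f g \<in> borel_measurable P"
    unfolding half[abs_def] by measurable
  have "integrable P (\<lambda>x. (Ln_component P Q c fs gs fn gn f g x)\<^sup>2)"
  proof (rule Bochner_Integration.integrable_bound)
    show "integrable P (\<lambda>x. 2 * (f x)\<^sup>2 + 2 * c\<^sup>2 * (2 * (f x)\<^sup>2 + 2 * (LINT y|Q. (g y)\<^sup>2)))"
      using sqf by simp
    have "(Ln_component P Q c fs gs fn gn f g x)\<^sup>2 \<le> 2 * (f x)\<^sup>2 + 2 * c\<^sup>2 * (2 * (f x)\<^sup>2 + 2 * (LINT y|Q. (g y)\<^sup>2))"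
      if x: "x \<in> spt P" for x
    proof -
      have "((LINT z:?E x|?\<mu>. f x + g (snd z)) - (LINT z:({} :: (real \<times> 'a) set)|(lborel \<Otimes>\<^sub>M Q). f x + g (snd z)))\<^sup>2
          \<le> measure Q UNIV * (LINT y|Q. (f x + g y)\<^sup>2)"
        by (rule Q.strip_integral_diff_square_le[where h = "\<lambda>y. f x + g y" and E = "?E x" and E' = "{}" and D = UNIV])
          (use Sn_set_sets[OF cont x] Sn_set_subset Q.shifted_square_integral_le(1)[OF g]
            in \<open>auto simp: Q.sets_borel\<close>)
      then have "(A x)\<^sup>2 \<le> 2 * (f x)\<^sup>2 + 2 * (LINT y|Q. (g y)\<^sup>2)"
        using Q.shifted_square_integral_le(2)[OF g, of "f x"] Q.prob_space
        by (simp add: A[OF x] set_lebesgue_integral_def Q.space_UNIV)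
      then have "2 * c\<^sup>2 * (A x)\<^sup>2 \<le> 2 * c\<^sup>2 * (2 * (f x)\<^sup>2 + 2 * (LINT y|Q. (g y)\<^sup>2))"
        by (intro mult_left_mono) auto
      moreover have "(f x - c * A x)\<^sup>2 \<le> 2 * (f x)\<^sup>2 + 2 * c\<^sup>2 * (A x)\<^sup>2"
        using zero_le_power2[of "f x + c * A x"] by (simp add: power2_eq_square algebra_simps)
      ultimately show ?thesis using x by (simp add: half)
    qed
    then have "(Ln_component P Q c fs gs fn gn f g x)\<^sup>2 \<le> 2 * (f x)\<^sup>2 + 2 * c\<^sup>2 * (2 * (f x)\<^sup>2 + 2 * (LINT y|Q. (g y)\<^sup>2))" for x
      by (cases "x \<in> spt P") (simp_all add: Ln_component_def)
    then show "AE x in P. norm ((Ln_component P Q c fs gs fn gn f g x)\<^sup>2)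
        \<le> norm (2 * (f x)\<^sup>2 + 2 * c\<^sup>2 * (2 * (f x)\<^sup>2 + 2 * (LINT y|Q. (g y)\<^sup>2)))"
      by simp
  qed simp
  then show ?thesis using meas by (simp add: L2_space_def)
qed

lemma Ln_component_diff_integral_le:
  assumes cont: "continuous_on (spt P) fs" "continuous_on (spt P) fn"
    "continuous_on (spt Q) gs" "continuous_on (spt Q) gn"
    and f: "f \<in> L2_space P" and g: "g \<in> L2_space Q"
    and \<omega>: "\<And>x. x \<in> spt P \<Longrightarrow>
      measure Q {y \<in> spt Q. (0 \<le> slack fs gs x y) \<noteq> (0 \<le> slack fn gn x y)} \<le> \<omega>" "0 \<le> \<omega>"
  shows "(LINT x|P. (Ln_component P Q c fs gs fn gn f g x - Ln_component P Q c fs gs fs gs f g x)\<^sup>2)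
    \<le> c\<^sup>2 * \<omega> * (2 * (LINT x|P. (f x)\<^sup>2) + 2 * (LINT y|Q. (g y)\<^sup>2))"
proof -
  have sqf: "integrable P (\<lambda>x. (f x)\<^sup>2)" using f by (auto simp: L2_space_def)
  have "(LINT x|P. (Ln_component P Q c fs gs fn gn f g x - Ln_component P Q c fs gs fs gs f g x)\<^sup>2)
      \<le> (LINT x|P. c\<^sup>2 * \<omega> * (2 * (f x)\<^sup>2 + 2 * (LINT y|Q. (g y)\<^sup>2)))"
  proof (rule integral_mono_AE')
    show "integrable P (\<lambda>x. c\<^sup>2 * \<omega> * (2 * (f x)\<^sup>2 + 2 * (LINT y|Q. (g y)\<^sup>2)))" using sqf by simp
    have "(Ln_component P Q c fs gs fn gn f g x - Ln_component P Q c fs gs fs gs f g x)\<^sup>2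
        \<le> c\<^sup>2 * \<omega> * (2 * (f x)\<^sup>2 + 2 * (LINT y|Q. (g y)\<^sup>2))" for x
    proof (cases "x \<in> spt P")
      case True
      have "c\<^sup>2 * measure Q {y \<in> spt Q. (0 \<le> slack fs gs x y) \<noteq> (0 \<le> slack fn gn x y)}
          * (2 * (f x)\<^sup>2 + 2 * (LINT y|Q. (g y)\<^sup>2)) \<le> c\<^sup>2 * \<omega> * (2 * (f x)\<^sup>2 + 2 * (LINT y|Q. (g y)\<^sup>2))"
        using \<omega>(1)[OF True] by (intro mult_left_mono mult_right_mono add_nonneg_nonneg) auto
      with Ln_component_diff_square_le[OF cont g True, of c f] show ?thesis by linarith
    qed (use \<omega>(2) in \<open>simp add: Ln_component_def\<close>)
    then show "AE x in P. (Ln_component P Q c fs gs fn gn f g x - Ln_component P Q c fs gs fs gs f g x)\<^sup>2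
        \<le> c\<^sup>2 * \<omega> * (2 * (f x)\<^sup>2 + 2 * (LINT y|Q. (g y)\<^sup>2))" by simp
    show "AE x in P. 0 \<le> c\<^sup>2 * \<omega> * (2 * (f x)\<^sup>2 + 2 * (LINT y|Q. (g y)\<^sup>2))"
      using \<omega>(2) by (intro AE_I2 mult_nonneg_nonneg add_nonneg_nonneg) auto
  qed
  also have "\<dots> = c\<^sup>2 * \<omega> * (2 * (LINT x|P. (f x)\<^sup>2) + 2 * (LINT y|Q. (g y)\<^sup>2))"
    using sqf P.prob_space by simp
  finally show ?thesis .
qed

end

section \<open>Projection and operator norm\<close>

context prob_space
begin

lemma L2_space_diff:
  assumes "f \<in> L2_space M" "g \<in> L2_space M"
  shows "(\<lambda>x. f x - g x) \<in> L2_space M"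
proof -
  have [measurable]: "f \<in> borel_measurable M" "g \<in> borel_measurable M"
    and sq: "integrable M (\<lambda>x. (f x)\<^sup>2)" "integrable M (\<lambda>x. (g x)\<^sup>2)"
    using assms by (auto simp: L2_space_def)
  have "integrable M (\<lambda>x. (f x)\<^sup>2 + (g x)\<^sup>2 - 2 * (f x * g x))"
    using sq integral_Cauchy_Schwarz(1)[of f M g] by simp
  also have "(\<lambda>x. (f x)\<^sup>2 + (g x)\<^sup>2 - 2 * (f x * g x)) = (\<lambda>x. (f x - g x)\<^sup>2)"
    by (auto simp: power2_eq_square algebra_simps)
  finally show ?thesis by (simp add: L2_space_def)
qed

lemma integral_shifted_square:
  assumes g: "g \<in> L2_space M"
  shows "(LINT y|M. (a + g y)\<^sup>2) = a\<^sup>2 + 2 * a * (LINT y|M. g y) + (LINT y|M. (g y)\<^sup>2)"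
proof -
  have "(LINT y|M. (a + g y)\<^sup>2) = (LINT y|M. a\<^sup>2 + 2 * a * g y + (g y)\<^sup>2)"
    by (intro Bochner_Integration.integral_cong) (auto simp: power2_eq_square algebra_simps)
  then show ?thesis
    using g L2_space_integrable[OF g] prob_space by (simp add: L2_space_def)
qed

end

context qot
begin

text \<open>
  The projection is linear on integrable pairs, shifts the two means to their midpoint, and lowers
  the squared norm by twice the square of the shift \<open>t\<close>.
\<close>
lemma proj_oplus_diff:
  assumes a: "a \<in> L2_space P" "a' \<in> L2_space P" and b: "b \<in> L2_space Q" "b' \<in> L2_space Q"
  defines "w \<equiv> pair_diff (proj_oplus P Q (a, b)) (proj_oplus P Q (a', b'))"
  shows "w \<in> L2_oplus P Q"
    and "L2_norm P Q w \<le> sqrt ((LINT x|P. (a x - a' x)\<^sup>2) + (LINT y|Q. (b y - b' y)\<^sup>2))"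
proof -
  define \<alpha> \<beta> where "\<alpha> x = a x - a' x" and "\<beta> y = b y - b' y" for x y
  define A B where "A = (LINT x|P. \<alpha> x)" and "B = (LINT y|Q. \<beta> y)"
  define t where "t = (B - A) / 2"
  have \<alpha>: "\<alpha> \<in> L2_space P" and \<beta>: "\<beta> \<in> L2_space Q"
    unfolding \<alpha>_def[abs_def] \<beta>_def[abs_def]
    using a b by (auto intro: P.L2_space_diff Q.L2_space_diff)
  note ints = P.L2_space_integrable[OF a(1)] P.L2_space_integrable[OF a(2)]
    Q.L2_space_integrable[OF b(1)] Q.L2_space_integrable[OF b(2)]
    P.L2_space_integrable[OF \<alpha>] Q.L2_space_integrable[OF \<beta>]
  have A: "A = (LINT x|P. a x) - (LINT x|P. a' x)" and B: "B = (LINT y|Q. b y) - (LINT y|Q. b' y)"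
    using ints by (simp_all add: A_def B_def \<alpha>_def \<beta>_def)
  have w: "w = (\<lambda>x. t + \<alpha> x, \<lambda>y. - t + \<beta> y)"
    by (auto simp: w_def pair_diff_def proj_oplus_def \<alpha>_def \<beta>_def t_def A B field_simps)
  have "(LINT x|P. t + \<alpha> x) = (LINT y|Q. - t + \<beta> y)"
  proof -
    have "(LINT x|P. t + \<alpha> x) = t + A" "(LINT y|Q. - t + \<beta> y) = - t + B"
      using ints P.prob_space Q.prob_space by (simp_all add: A_def B_def)
    then show ?thesis by (simp add: t_def field_simps)
  qed
  then show "w \<in> L2_oplus P Q"
    using P.shifted_square_integral_le(1)[OF \<alpha>, of t] Q.shifted_square_integral_le(1)[OF \<beta>, of "- t"]
    by (simp add: w L2_oplus_def)
  have "(LINT x|P. (t + \<alpha> x)\<^sup>2) + (LINT y|Q. (- t + \<beta> y)\<^sup>2)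
      = (LINT x|P. (\<alpha> x)\<^sup>2) + (LINT y|Q. (\<beta> y)\<^sup>2) - 2 * t\<^sup>2"
    unfolding P.integral_shifted_square[OF \<alpha>] Q.integral_shifted_square[OF \<beta>] A_def[symmetric] B_def[symmetric]
    by (simp add: t_def power2_eq_square field_simps)
  then have "(LINT x|P. (t + \<alpha> x)\<^sup>2) + (LINT y|Q. (- t + \<beta> y)\<^sup>2)
      \<le> (LINT x|P. (\<alpha> x)\<^sup>2) + (LINT y|Q. (\<beta> y)\<^sup>2)"
    by simp
  then show "L2_norm P Q w \<le> sqrt ((LINT x|P. (a x - a' x)\<^sup>2) + (LINT y|Q. (b y - b' y)\<^sup>2))"
    by (simp add: w L2_norm_def \<alpha>_def \<beta>_def)
qed

end

context qot_descent
begin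

lemma op_norm_le:
  assumes \<omega>: "0 \<le> \<omega>"
    and Q_bd: "\<And>x. x \<in> spt P \<Longrightarrow>
      measure Q {y \<in> spt Q. (0 \<le> slack fs gs x y) \<noteq> (0 \<le> slack (F n) (G n) x y)} \<le> \<omega>"
    and P_bd: "\<And>y. y \<in> spt Q \<Longrightarrow>
      measure P {x \<in> spt P. (0 \<le> slack fs gs x y) \<noteq> (0 \<le> slack (F n) (G n) x y)} \<le> \<omega>"
  shows "op_norm_oplus P Q (\<lambda>u. pair_diff (Ln_op P Q \<epsilon> \<eta> fs gs (gd_iter P Q \<epsilon> \<eta> f0 g0 n) u)
      (L_op P Q \<epsilon> \<eta> fs gs u)) \<le> ennreal (2 * (\<eta> / \<epsilon>) * sqrt \<omega>)"
  unfolding op_norm_oplus_def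
proof (rule Inf_lower, rule CollectI, intro exI[of _ "2 * (\<eta> / \<epsilon>) * sqrt \<omega>"] conjI refl ballI)
  interpret sw: qot Q P \<epsilon> by (rule swap)
  let ?c = "\<eta> / \<epsilon>"
  have c: "0 \<le> ?c" using eta eps by simp
  show C: "0 \<le> 2 * ?c * sqrt \<omega>" using c \<omega> by (intro mult_nonneg_nonneg) auto
  fix u assume u: "u \<in> L2_oplus P Q"
  obtain f g where fg: "u = (f, g)" by (cases u)
  have f: "f \<in> L2_space P" and g: "g \<in> L2_space Q"
    using u by (auto simp: fg L2_oplus_def)
  let ?a = "Ln_component P Q ?c fs gs (F n) (G n) f g" and ?a' = "Ln_component P Q ?c fs gs fs gs f g"
  let ?b = "Ln_component Q P ?c gs fs (G n) (F n) g f" and ?b' = "Ln_component Q P ?c gs fs gs fs g f"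
  let ?T = "pair_diff (Ln_op P Q \<epsilon> \<eta> fs gs (gd_iter P Q \<epsilon> \<eta> f0 g0 n) u) (L_op P Q \<epsilon> \<eta> fs gs u)"
  note cont = continuous_fs continuous_F[of n] continuous_gs continuous_G[of n]
  note cont_sw = cont(3,4,1,2)
  have Ln: "Ln_op P Q \<epsilon> \<eta> fs gs (gd_iter P Q \<epsilon> \<eta> f0 g0 n) u = proj_oplus P Q (?a, ?b)"
    by (simp add: Ln_op_eq_proj_components fg F_def G_def)
  have L: "L_op P Q \<epsilon> \<eta> fs gs u = proj_oplus P Q (?a', ?b')"
    unfolding L_op_def fg Ln_component_at_potentials[OF continuous_gs g, abs_def]
      sw.Ln_component_at_potentials[OF continuous_fs f, abs_def] T_set_eq_S_set
    by simp
  have a: "?a \<in> L2_space P" "?a' \<in> L2_space P"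
    using cont f g by (auto intro!: Ln_component_L2)
  have b: "?b \<in> L2_space Q" "?b' \<in> L2_space Q"
    using cont f g by (auto intro!: sw.Ln_component_L2)
  have T: "?T = pair_diff (proj_oplus P Q (?a, ?b)) (proj_oplus P Q (?a', ?b'))"
    by (simp only: Ln L)
  show "?T \<in> L2_oplus P Q" unfolding T by (rule proj_oplus_diff(1)[OF a b])
  have 1: "(LINT x|P. (?a x - ?a' x)\<^sup>2) \<le> ?c\<^sup>2 * \<omega> * (2 * (LINT x|P. (f x)\<^sup>2) + 2 * (LINT y|Q. (g y)\<^sup>2))"
    using Ln_component_diff_integral_le[OF cont f g Q_bd \<omega>] .
  have 2: "(LINT y|Q. (?b y - ?b' y)\<^sup>2) \<le> ?c\<^sup>2 * \<omega> * (2 * (LINT y|Q. (g y)\<^sup>2) + 2 * (LINT x|P. (f x)\<^sup>2))"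
    by (rule sw.Ln_component_diff_integral_le[OF cont_sw g f _ \<omega>])
       (use P_bd in \<open>simp add: slack_commute[of gs fs] slack_commute[of "G n" "F n"]\<close>)
  have "L2_norm P Q ?T \<le> sqrt ((LINT x|P. (?a x - ?a' x)\<^sup>2) + (LINT y|Q. (?b y - ?b' y)\<^sup>2))"
    unfolding T by (rule proj_oplus_diff(2)[OF a b])
  also have "\<dots> \<le> sqrt ((2 * ?c)\<^sup>2 * \<omega> * ((LINT x|P. (f x)\<^sup>2) + (LINT y|Q. (g y)\<^sup>2)))"
    using add_mono[OF 1 2] by (intro real_sqrt_le_mono) (simp add: algebra_simps power2_eq_square)
  also have "\<dots> = 2 * ?c * sqrt \<omega> * L2_norm P Q u"
    using eta eps by (simp add: real_sqrt_mult fg L2_norm_def)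
  finally show "L2_norm P Q ?T \<le> 2 * ?c * sqrt \<omega> * L2_norm P Q u" .
qed

end

theorem proposition5p6:
  fixes P Q :: "(real ^ 'd) measure"
    and \<epsilon> \<eta> :: real
    and f0 g0 fs gs :: "real ^ 'd \<Rightarrow> real"
  assumes eps: "0 < \<epsilon>"
    and P: "prob_space P" "sets P = sets borel"
    and Q: "prob_space Q" "sets Q = sets borel"
    and P_frontier: "\<And>C. convex C \<Longrightarrow> measure P (frontier C) = 0"
    and Q_frontier: "\<And>C. convex C \<Longrightarrow> measure Q (frontier C) = 0"
    and spt_P: "compact (spt P)"
    and spt_Q: "compact (spt Q)" "connected (spt Q)"
    and f0: "\<exists>K. K-lipschitz_on (spt P) f0"
    and g0: "\<exists>K. K-lipschitz_on (spt Q) g0"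
    and f0_g0: "(LINT x:spt P|P. f0 x) = (LINT y:spt Q|Q. g0 y)"
    and eta: "0 < \<eta>" "\<eta> < \<epsilon>"
    and pot: "potentials P Q \<epsilon> fs gs"
  shows "(\<lambda>n. op_norm_oplus P Q
            (\<lambda>u. pair_diff (Ln_op P Q \<epsilon> \<eta> fs gs (gd_iter P Q \<epsilon> \<eta> f0 g0 n) u)
                           (L_op P Q \<epsilon> \<eta> fs gs u)))
         \<longlonglongrightarrow> 0"
proof -
  interpret P: compactly_supported_prob P
    using P spt_P by (simp add: compactly_supported_prob_def compactly_supported_prob_axioms_def)
  interpret Q: compactly_supported_prob Q
    using Q spt_Q(1) by (simp add: compactly_supported_prob_def compactly_supported_prob_axioms_def)
  obtain Kf Kg where Kf: "Kf-lipschitz_on (spt P) f0" and Kg: "Kg-lipschitz_on (spt Q) g0"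
    using f0 g0 by blast
  obtain R where R: "\<And>x y. x \<in> spt P \<Longrightarrow> y \<in> spt Q \<Longrightarrow> norm (x - y) \<le> R"
  proof -
    have "bounded ((\<lambda>z. fst z - snd z) ` (spt P \<times> spt Q))"
      using spt_P spt_Q(1)
      by (intro compact_imp_bounded compact_continuous_image compact_Times continuous_intros)
    then show ?thesis using that by (fastforce simp: bounded_iff)
  qed
  define K where "K = max R (max Kf Kg)"
  have lip: "K-lipschitz_on (spt P) f0" "K-lipschitz_on (spt Q) g0"
    using lipschitz_on_le[OF Kf, of K] lipschitz_on_le[OF Kg, of K] by (auto simp: K_def)
  interpret qot_descent P Q \<epsilon> \<eta> K fs gs f0 g0
    using eps eta lip pot R by unfold_locales (auto simp: solves_dual_def potentials_def K_def le_max_iff_disj)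
  interpret sw: qot_descent Q P \<epsilon> \<eta> K gs fs g0 f0 by (rule swap_descent)
  have swF: "sw.F n = G n" and swG: "sw.G n = F n" for n
    by (simp_all add: sw.F_def sw.G_def F_def G_def gd_iter_swap[of Q P])
  let ?N = "\<lambda>n. op_norm_oplus P Q
            (\<lambda>u. pair_diff (Ln_op P Q \<epsilon> \<eta> fs gs (gd_iter P Q \<epsilon> \<eta> f0 g0 n) u)
                           (L_op P Q \<epsilon> \<eta> fs gs u))"
  show ?thesis
  proof (rule order_tendstoI)
    fix a :: ennreal assume "0 < a"
    then obtain a' where a': "0 < a'" "a' < a" using dense by blast
    define e where "e = enn2real a'"
    have "a' < \<top>" using a'(2) by (rule less_le_trans) simp
    then have e: "ennreal e = a'" "0 < e"
      using a'(1) by (simp_all add: e_def enn2real_positive_iff)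
    \<comment> \<open>the value of \<open>\<omega>\<close> for which the operator norm bound equals \<open>e\<close>\<close>
    define \<omega> where "\<omega> = (e * \<epsilon> / (2 * \<eta>))\<^sup>2"
    have sqrt_\<omega>: "2 * (\<eta> / \<epsilon>) * sqrt \<omega> = e"
      using e(2) eps eta by (simp add: \<omega>_def)
    have \<omega>: "0 < \<omega>" using e(2) eps eta by (simp add: \<omega>_def)
    have "\<forall>\<^sub>F n in sequentially. (\<forall>x\<in>spt P. measure Q (mismatch n x) < \<omega>) \<and>
        (\<forall>y\<in>spt Q. measure P (sw.mismatch n y) < \<omega>)"
      using mismatch_small[OF Q_frontier \<omega>] sw.mismatch_small[OF P_frontier \<omega>]
      by (rule eventually_conj)
    then show "\<forall>\<^sub>F n in sequentially. ?N n < a"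
    proof eventually_elim
      case (elim n)
      have "?N n \<le> ennreal (2 * (\<eta> / \<epsilon>) * sqrt \<omega>)"
      proof (rule op_norm_le)
        show "0 \<le> \<omega>" using \<omega> by simp
        show "measure Q {y \<in> spt Q. (0 \<le> slack fs gs x y) \<noteq> (0 \<le> slack (F n) (G n) x y)} \<le> \<omega>"
          if "x \<in> spt P" for x
          using elim that by (auto simp: mismatch_def intro: less_imp_le)
        show "measure P {x \<in> spt P. (0 \<le> slack fs gs x y) \<noteq> (0 \<le> slack (F n) (G n) x y)} \<le> \<omega>"
          if "y \<in> spt Q" for y
          using elim that
          by (auto simp: sw.mismatch_def swF swG slack_commute[of gs fs] slack_commute[of "G n" "F n"]
              intro: less_imp_le)
      qed
      also have "\<dots> < a" using a'(2) by (simp only: sqrt_\<omega> e(1))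
      finally show ?case .
    qed
  qed simp
qed

end
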